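(* Let $n$ be a positive integer and $k$ a non-negative integer, and let $\mathcal{H}_n^k = \{h_k(2\pi t/n) \mid t\in\mathbb{Z}\}\subset\mathbb{R}^{2k+1}$. Then any $n+1$ consecutive Voronoi regions in the Voronoi diagram of $\mathcal{H}_n^k$, that is, the Voronoi regions (with respect to the whole infinite set $\mathcal{H}_n^k$) of the points $h_k(2\pi t/n)$ for $t=m,m+1,\dots,m+n$ with $m\in\mathbb{Z}$, form a $(k+1)$-neighborly family of congruent convex polyhedra.
   Context: The generalized helix is the curve $h_k(t) = (t, \cos t, \sin t, \cos 2t, \sin 2t, \dots, \cos kt, \sin kt)\in\mathbb{R}^{2k+1}$. The Voronoi region of a point $p$ of a point set $S\subset\mathbb{R}^d$ is the set of all $x\in\mathbb{R}^d$ with $|x-p|\le|x-q|$ for all $q\in S$. A convex polyhedron in $\mathbb{R}^d$ is an intersection, possibly unbounded, of finitely many closed halfspaces. Polyhedra are congruent if each is the image of any other under an isometry of $\mathbb{R}^d$. A family of convex polyhedra in $\mathbb{R}^d$ is (strictly) $j$-neighborly if any subset of $j$ of the polyhedra has a $(d-j+1)$-dimensional intersection, and no subset of $j+1$ of them has a non-empty intersection.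
   Formalization: "(k+1)-neighborly" is taken without the clause that no k+2 of the polyhedra intersect (read as belonging to "strictly" only); with it the claim fails, e.g. for k=0, n=1 adjacent intervals share an endpoint, and it is vacuous for n ≤ k. *)

theory Defs
  imports "HOL-Analysis.Analysis"
begin

(* The coordinates of \<real>^(2k+1) are addressed through an arbitrary enumeration
   e 0, ..., e (2k) of the index type 'n; it is only meaningful when e maps {..2*k}
   bijectively onto UNIV :: 'n set.  Coordinate 0 is t, coordinates 2j-1 and 2j are
   cos (j t) and sin (j t). *)
definition gen_helix :: "nat \<Rightarrow> (nat \<Rightarrow> 'n::finite) \<Rightarrow> real \<Rightarrow> real ^ 'n" where
  "gen_helix k e t =
     t *\<^sub>R axis (e 0) 1 +
     (\<Sum>j=1..k. cos (real j * t) *\<^sub>R axis (e (2 * j - 1)) 1 +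
                sin (real j * t) *\<^sub>R axis (e (2 * j)) 1)"

definition helix_point :: "nat \<Rightarrow> (nat \<Rightarrow> 'n::finite) \<Rightarrow> nat \<Rightarrow> int \<Rightarrow> real ^ 'n" where
  "helix_point k e n t = gen_helix k e (2 * pi * of_int t / of_nat n)"

definition helix_points :: "nat \<Rightarrow> (nat \<Rightarrow> 'n::finite) \<Rightarrow> nat \<Rightarrow> (real ^ 'n) set" where
  "helix_points k e n = range (helix_point k e n)"

definition voronoi_region :: "'a::metric_space set \<Rightarrow> 'a \<Rightarrow> 'a set" where
  "voronoi_region S p = {x. \<forall>q\<in>S. dist x p \<le> dist x q}"

definition congruent_sets :: "'a::metric_space set \<Rightarrow> 'a set \<Rightarrow> bool" where
  "congruent_sets A B \<longleftrightarrow>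
     (\<exists>f. bij f \<and> (\<forall>x y. dist (f x) (f y) = dist x y) \<and> f ` A = B)"

(* A family of convex polyhedra is indexed by a set I, so repeated members count separately.
   The additional requirement that no j+1 members have a common point is what distinguishes
   strictly j-neighborly families from j-neighborly ones; it is not part of this definition
   (adjacent Voronoi regions of points on a line, the case j = 1, share an endpoint). *)
definition neighborly_family ::
  "nat \<Rightarrow> 'i set \<Rightarrow> ('i \<Rightarrow> 'a::euclidean_space set) \<Rightarrow> bool" where
  "neighborly_family j I P \<longleftrightarrow>
     (\<forall>i\<in>I. polyhedron (P i)) \<and>
     (\<forall>J\<subseteq>I. finite J \<and> card J = j \<longrightarrow>
        aff_dim (\<Inter>i\<in>J. P i) = int DIM('a) - int j + 1)"

definition congruent_family :: "'i set \<Rightarrow> ('i \<Rightarrow> 'a::metric_space set) \<Rightarrow> bool" where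
  "congruent_family I P \<longleftrightarrow> (\<forall>i\<in>I. \<forall>j\<in>I. congruent_sets (P i) (P j))"

end

theory Submission
  imports Defs "HOL-Computational_Algebra.Polynomial"
begin

text \<open>
  Along the helix, the squared distance to a fixed point, minus a constant, is a function
  \<open>f(s) = s\<^sup>2 + B s + p(s)\<close> with \<open>p\<close> a trigonometric polynomial of degree \<open>k\<close>. As a
  nonzero trigonometric polynomial of degree \<open>k\<close> has at most \<open>2k\<close> zeros per period, Rolle's theorem
  applied to \<open>f\<close> and \<open>f'\<close> shows that \<open>f\<close> has at most \<open>2k + 2\<close> zeros in a closed interval of length
  \<open>2\<pi>\<close>, all of them simple if there are \<open>2k + 2\<close>. The same count shows that
  the points \<open>(1, h(s))\<close> at \<open>2k + 2\<close> parameters in such an interval are linearly independent,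
  so there is a sphere through the corresponding helix points.

  Let \<open>k \<ge> 1\<close>. Given \<open>k + 1\<close> of the \<open>n + 1\<close> consecutive lattice parameters, add next to each of them a second
  parameter at a third of the lattice spacing, on the side that keeps the interval short. On the
  sphere through these \<open>2k + 2\<close> points \<open>f\<close> changes sign twice around each chosen lattice
  parameter and never between two other neighbouring ones, so \<open>f\<close> has one sign on the remaining lattice
  parameters nearby. Since \<open>f(s + 2\<pi>) - f(s)\<close> is an increasing affine function of \<open>s\<close>, this sign
  is positive and persists on the whole lattice. Hence all other points are strictly outside
  the sphere, and near its centre the intersection of the Voronoi regions is the affine space of points
  equidistant from the \<open>k + 1\<close> chosen ones. The same affine difference shows that each
  Voronoi region is cut out by the \<open>n\<close> nearest lattice points on either side, and screw motions
  along the helix give the congruences.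
\<close>

section \<open>Zeros of trigonometric polynomials\<close>

definition trig_poly :: "nat \<Rightarrow> (nat \<Rightarrow> real) \<Rightarrow> (nat \<Rightarrow> real) \<Rightarrow> real \<Rightarrow> real" where
  "trig_poly k \<alpha> \<beta> t = (\<Sum>j\<le>k. \<alpha> j * cos (real j * t) + \<beta> j * sin (real j * t))"

lemma has_derivative_trig_poly:
  "(trig_poly k \<alpha> \<beta> has_real_derivative
     trig_poly k (\<lambda>j. real j * \<beta> j) (\<lambda>j. - real j * \<alpha> j) t) (at t)"
  unfolding trig_poly_def
  by (auto intro!: derivative_eq_intros sum.cong simp: algebra_simps)

lemma trig_poly_periodic: "trig_poly k \<alpha> \<beta> (t + 2 * pi) = trig_poly k \<alpha> \<beta> t"
proof -
  have "cos (real j * (t + 2 * pi)) = cos (real j * t)"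
       "sin (real j * (t + 2 * pi)) = sin (real j * t)" for j
    using cos.plus_of_nat[of "real j * t" j] sin.plus_of_nat[of "real j * t" j]
    by (simp_all add: algebra_simps)
  then show ?thesis by (simp add: trig_poly_def)
qed

text \<open>Write cosines and sines through powers of \<open>cis t\<close> and multiply by
  \<open>cis t ^ k\<close> to clear negative exponents. The coefficients above degree
  \<open>k\<close> already determine \<alpha> and \<beta> at positive indices. At
  \<open>j = 0\<close> both monomials have degree \<open>k\<close>, and \<beta> at 0
  cancels.\<close>

lemma trig_poly_complex_poly:
  obtains P :: "complex poly"
  where "degree P \<le> 2 * k"
    and "\<And>t. poly P (cis t) = cis (real k * t) * of_real (trig_poly k \<alpha> \<beta> t)"
    and "\<And>j. j \<in> {1..k} \<Longrightarrow> coeff P (k + j) = Complex (\<alpha> j) (- \<beta> j) / 2"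
proof
  define P where "P = (\<Sum>j\<le>k. monom (Complex (\<alpha> j) (- \<beta> j) / 2) (k + j)
    + monom (Complex (\<alpha> j) (\<beta> j) / 2) (k - j))"
  show "degree P \<le> 2 * k"
    unfolding P_def
    by (intro degree_sum_le degree_add_le order.trans[OF degree_monom_le]) auto
  show "poly P (cis t) = cis (real k * t) * of_real (trig_poly k \<alpha> \<beta> t)" for t
  proof -
    have "poly (monom (Complex (\<alpha> j) (- \<beta> j) / 2) (k + j)
        + monom (Complex (\<alpha> j) (\<beta> j) / 2) (k - j)) (cis t)
      = cis (real k * t) * of_real (\<alpha> j * cos (real j * t) + \<beta> j * sin (real j * t))"
      if "j \<le> k" for j
    proof -
      have "cis t ^ (k + j) = cis (real k * t) * cis (real j * t)"
           "cis t ^ (k - j) = cis (real k * t) * cis (- (real j * t))"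
        using that by (simp_all add: Complex.DeMoivre cis_mult algebra_simps of_nat_diff)
      then have "poly (monom (Complex (\<alpha> j) (- \<beta> j) / 2) (k + j)
        + monom (Complex (\<alpha> j) (\<beta> j) / 2) (k - j)) (cis t)
        = cis (real k * t) * (Complex (\<alpha> j) (- \<beta> j) / 2 * cis (real j * t)
           + Complex (\<alpha> j) (\<beta> j) / 2 * cis (- (real j * t)))"
        by (simp add: poly_monom algebra_simps)
      also have "Complex (\<alpha> j) (- \<beta> j) / 2 * cis (real j * t)
           + Complex (\<alpha> j) (\<beta> j) / 2 * cis (- (real j * t))
          = of_real (\<alpha> j * cos (real j * t) + \<beta> j * sin (real j * t))"
        by (simp add: complex_eq_iff field_simps)
      finally show ?thesis .
    qed
    then show ?thesis
      by (simp add: P_def trig_poly_def poly_sum sum_distrib_left)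
  qed
  show "coeff P (k + j) = Complex (\<alpha> j) (- \<beta> j) / 2" if "j \<in> {1..k}" for j
  proof -
    have "coeff P (k + j) = (\<Sum>i\<le>k. if i = j then Complex (\<alpha> j) (- \<beta> j) / 2 else 0)"
      unfolding P_def coeff_sum using that by (intro sum.cong) auto
    then show ?thesis using that by simp
  qed
qed

lemma two_pi_pos: "0 < 2 * pi"
  by simp

lemma inj_on_cis_period: "inj_on cis {u..<u + 2 * pi}"
proof
  fix x y assume *: "x \<in> {u..<u + 2 * pi}" "y \<in> {u..<u + 2 * pi}" "cis x = cis y"
  then have "sin y = sin x \<and> cos y = cos x" by (simp add: complex_eq_iff)
  then obtain i :: int where i: "y = x + 2 * pi * i" by (auto simp: sin_cos_eq_iff)
  then have "2 * pi * real_of_int i = y - x" by simp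
  with *(1,2) have "2 * pi * real_of_int i < 2 * pi * 1" "2 * pi * (- 1) < 2 * pi * real_of_int i"
    unfolding atLeastLessThan_iff by linarith+
  then have "real_of_int i < 1" "- 1 < real_of_int i"
    by (simp_all only: mult_less_cancel_left_pos[OF two_pi_pos])
  then have "i = 0" by linarith
  with i show "x = y" by simp
qed

text \<open>On a half-open period distinct zeros give distinct points on the unit circle, so the
  associated complex polynomial has more roots than its degree allows and vanishes. Its coefficients
  give the positive indices, and the value at 0 then gives the constant term. Nothing is claimed
  about \<beta> at 0, since \<open>sin 0 = 0\<close>.\<close>

lemma
  assumes "finite Z" "card Z \<ge> 2 * k + 1" "Z \<subseteq> {u..<u + 2 * pi}"
    and "\<And>z. z \<in> Z \<Longrightarrow> trig_poly k \<alpha> \<beta> z = 0"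
  shows trig_poly_eq_0: "trig_poly k \<alpha> \<beta> t = 0"
    and trig_poly_coeff_eq_0: "j \<in> {1..k} \<Longrightarrow> \<alpha> j = 0 \<and> \<beta> j = 0"
    and trig_poly_const_eq_0: "\<alpha> 0 = 0"
proof -
  obtain P :: "complex poly" where deg: "degree P \<le> 2 * k"
    and ev: "\<And>t. poly P (cis t) = cis (real k * t) * of_real (trig_poly k \<alpha> \<beta> t)"
    and co: "\<And>j. j \<in> {1..k} \<Longrightarrow> coeff P (k + j) = Complex (\<alpha> j) (- \<beta> j) / 2"
    using trig_poly_complex_poly by blast
  have "P = 0"
  proof (rule ccontr)
    assume "P \<noteq> 0"
    have "card Z = card (cis ` Z)"
      using assms(3) by (metis card_image inj_on_cis_period inj_on_subset)
    also have "\<dots> \<le> card {z. poly P z = 0}"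
      using assms(4) by (intro card_mono poly_roots_finite \<open>P \<noteq> 0\<close>) (auto simp: ev)
    also have "\<dots> \<le> 2 * k"
      using card_poly_roots_bound[OF \<open>P \<noteq> 0\<close>] deg by simp
    finally show False using assms(2) by simp
  qed
  then show *: "trig_poly k \<alpha> \<beta> t = 0" for t
    using ev[of t] by simp
  show **: "\<alpha> j = 0 \<and> \<beta> j = 0" if "j \<in> {1..k}" for j
    using co[OF that] \<open>P = 0\<close> by (simp add: complex_eq_iff)
  have "trig_poly k \<alpha> \<beta> 0 = (\<Sum>j\<le>k. if j = 0 then \<alpha> 0 else 0)"
    unfolding trig_poly_def using ** by (intro sum.cong) auto
  with * show "\<alpha> 0 = 0" by simp
qed

text \<open>Induction on the largest zero, with one new Rolle point between the previous maximum and
  the added zero. That \<open>Z'\<close> avoids \<open>Z\<close> is what later allows a double zero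
  to be counted as an additional zero of the derivative.\<close>

lemma rolle_zeros:
  fixes f f' :: "real \<Rightarrow> real"
  assumes "\<And>x. (f has_real_derivative f' x) (at x)"
    and "finite Z" "Z \<noteq> {}" "\<And>z. z \<in> Z \<Longrightarrow> f z = 0"
  obtains Z' where "finite Z'" "card Z = Suc (card Z')" "Z' \<subseteq> {Min Z<..<Max Z}" "Z \<inter> Z' = {}"
    "\<And>z. z \<in> Z' \<Longrightarrow> f' z = 0"
proof -
  have "\<exists>Z'. finite Z' \<and> card Z = Suc (card Z') \<and> Z' \<subseteq> {Min Z<..<Max Z} \<and> Z \<inter> Z' = {} \<and>
    (\<forall>z\<in>Z'. f' z = 0)"
    using assms(2-4)
  proof (induction Z rule: finite_linorder_max_induct)
    case empty
    then show ?case by simp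
  next
    case (insert b A)
    show ?case
    proof (cases "A = {}")
      case True
      then show ?thesis by (intro exI[of _ "{}"]) auto
    next
      case False
      with insert obtain Z' where Z': "finite Z'" "card A = Suc (card Z')"
        "Z' \<subseteq> {Min A<..<Max A}" "A \<inter> Z' = {}" "\<forall>z\<in>Z'. f' z = 0" by auto
      have lt: "Max A < b" using insert False by simp
      have "continuous_on {Max A..b} f"
        using assms(1) by (meson DERIV_isCont continuous_at_imp_continuous_on)
      moreover have "f (Max A) = f b" using insert False by simp
      ultimately obtain w where w: "Max A < w" "w < b" "f' w = 0"
        using Rolle_deriv[OF lt, of f "\<lambda>x. (*) (f' x)"] assms(1)
        by (metis has_field_derivative_def mult.right_neutral)
      have mm: "Min A \<le> Max A"
        using insert False by (meson Max_in Min_le)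
      have mx: "Max (insert b A) = b" "Min (insert b A) = Min A"
        using lt mm Max_insert[OF insert(1) False, of b] Min_insert[OF insert(1) False, of b] by auto
      have "w \<notin> Z'" using Z'(3) w by auto
      moreover have "w \<notin> A" using w insert(1) by (metis Max_ge not_le)
      moreover have "b \<notin> Z'" using Z'(3) lt by auto
      moreover have "Min A < w" using w mm by auto
      moreover have "b \<notin> A" using insert by auto
      ultimately show ?thesis using Z' w lt insert
        by (intro exI[of _ "insert w Z'"]) (unfold mx, auto)
    qed
  qed
  then show ?thesis using that by blast
qed

section \<open>Zero counts for a quadratic plus a trigonometric polynomial\<close>

definition quad_trig :: "real \<Rightarrow> real \<Rightarrow> nat \<Rightarrow> (nat \<Rightarrow> real) \<Rightarrow> (nat \<Rightarrow> real) \<Rightarrow> real \<Rightarrow> real" where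
  "quad_trig q b k \<alpha> \<beta> t = q * t\<^sup>2 + b * t + trig_poly k \<alpha> \<beta> t"

definition quad_trig_deriv :: "real \<Rightarrow> real \<Rightarrow> nat \<Rightarrow> (nat \<Rightarrow> real) \<Rightarrow> (nat \<Rightarrow> real) \<Rightarrow> real \<Rightarrow> real" where
  "quad_trig_deriv q b k \<alpha> \<beta> t =
     2 * q * t + b + trig_poly k (\<lambda>j. real j * \<beta> j) (\<lambda>j. - real j * \<alpha> j) t"

lemma has_derivative_quad_trig:
  "(quad_trig q b k \<alpha> \<beta> has_real_derivative quad_trig_deriv q b k \<alpha> \<beta> t) (at t)"
  unfolding quad_trig_def quad_trig_deriv_def
  by (auto intro!: derivative_eq_intros has_derivative_trig_poly)

text \<open>The periodic part cancels, so the increment over a period is affine in \<open>t\<close>,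
  with slope \<open>4 * pi * q\<close>. All comparisons between different periods rest on
  this.\<close>

lemma quad_trig_shift:
  "quad_trig q b k \<alpha> \<beta> (t + 2 * pi) = quad_trig q b k \<alpha> \<beta> t + 4 * pi * q * t + (4 * pi\<^sup>2 * q + 2 * pi * b)"
  unfolding quad_trig_def trig_poly_periodic by (simp add: power2_eq_square algebra_simps)

lemma quad_trig_deriv_shift:
  "quad_trig_deriv q b k \<alpha> \<beta> (t + 2 * pi) = quad_trig_deriv q b k \<alpha> \<beta> t + 4 * pi * q"
  unfolding quad_trig_deriv_def trig_poly_periodic by (simp add: algebra_simps)

lemma trig_poly_add_const:
  "c + trig_poly k \<alpha> \<beta> t = trig_poly k (\<alpha>(0 := \<alpha> 0 + c)) \<beta> t"
proof -
  have "trig_poly k (\<alpha>(0 := \<alpha> 0 + c)) \<beta> t - trig_poly k \<alpha> \<beta> t = (\<Sum>j\<le>k. if j = 0 then c else 0)"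
    unfolding trig_poly_def sum_subtractf[symmetric] by (intro sum.cong) (auto simp: algebra_simps)
  then show ?thesis by simp
qed

text \<open>The Rolle points lie strictly inside the closed interval, hence in a half-open period.
  There are at least \<open>2 * k + 1\<close> of them, so the derivative of \<open>g\<close>
  vanishes identically.\<close>

lemma const_add_trig_poly_many_zeros:
  assumes "finite Z" "card Z \<ge> 2 * k + 2" "Z \<subseteq> {u..u + 2 * pi}"
    and g: "\<And>t. (g has_real_derivative c + trig_poly k \<alpha> \<beta> t) (at t)"
    and "\<And>z. z \<in> Z \<Longrightarrow> g z = 0"
  shows "g s = g t"
proof -
  have ne: "Z \<noteq> {}" using assms(2) by auto
  obtain Z' where Z': "finite Z'" "card Z = Suc (card Z')" "Z' \<subseteq> {Min Z<..<Max Z}"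
    "\<And>z. z \<in> Z' \<Longrightarrow> c + trig_poly k \<alpha> \<beta> z = 0"
    using rolle_zeros[OF g assms(1) ne assms(5)] by metis
  have "u \<le> Min Z" "Max Z \<le> u + 2 * pi"
    using assms(1,3) ne by (meson Min_in Max_in atLeastAtMost_iff subsetD)+
  then have sub: "Z' \<subseteq> {u..<u + 2 * pi}" using Z'(3) by fastforce
  have "c + trig_poly k \<alpha> \<beta> t = 0" for t
    unfolding trig_poly_add_const
    using trig_poly_eq_0[OF Z'(1) _ sub] Z'(2,4) assms(2) by (simp add: trig_poly_add_const)
  then have "\<forall>t. (g has_real_derivative 0) (at t)" using g by metis
  then show ?thesis by (rule DERIV_isconst_all)
qed

text \<open>The case \<open>q = 0\<close> comes from linear functionals evaluated along the helix.
  The function is constant by the preceding count, while it grows by \<open>2 * pi * b\<close> over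
  a period.\<close>

lemma quad_trig_many_zeros_linear:
  assumes "finite Z" "card Z \<ge> 2 * k + 2" "Z \<subseteq> {u..u + 2 * pi}"
    and "\<And>z. z \<in> Z \<Longrightarrow> quad_trig 0 b k \<alpha> \<beta> z = 0"
  shows "b = 0"
proof -
  have "(quad_trig 0 b k \<alpha> \<beta> has_real_derivative
      b + trig_poly k (\<lambda>j. real j * \<beta> j) (\<lambda>j. - real j * \<alpha> j) t) (at t)" for t
    using has_derivative_quad_trig[of 0 b k \<alpha> \<beta> t] by (simp add: quad_trig_deriv_def)
  from const_add_trig_poly_many_zeros[OF assms(1-3) this assms(4)]
  have "quad_trig 0 b k \<alpha> \<beta> (0 + 2 * pi) = quad_trig 0 b k \<alpha> \<beta> 0" by blast
  \<comment> \<open>The sum \<open>0 + 2 * pi\<close> must stay unsimplified for the shift law to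
    match.\<close>
  then show ?thesis by (simp add: quad_trig_shift del: add_0)
qed

text \<open>The second derivative is a constant plus a trigonometric polynomial, so the first
  derivative is constant; but it grows by \<open>4 * pi * q\<close> over a period.\<close>

lemma quad_trig_deriv_many_zeros:
  assumes "finite Z" "card Z \<ge> 2 * k + 2" "Z \<subseteq> {u..u + 2 * pi}"
    and "\<And>z. z \<in> Z \<Longrightarrow> quad_trig_deriv q b k \<alpha> \<beta> z = 0"
  shows "q = 0"
proof -
  have "(quad_trig_deriv q b k \<alpha> \<beta> has_real_derivative 2 * q +
     trig_poly k (\<lambda>j. real j * (- real j * \<alpha> j)) (\<lambda>j. - real j * (real j * \<beta> j)) t) (at t)" for t
    unfolding quad_trig_deriv_def by (auto intro!: derivative_eq_intros has_derivative_trig_poly)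
  from const_add_trig_poly_many_zeros[OF assms(1-3) this assms(4)]
  have "quad_trig_deriv q b k \<alpha> \<beta> (0 + 2 * pi) = quad_trig_deriv q b k \<alpha> \<beta> 0" by blast
  then show ?thesis by (simp add: quad_trig_deriv_shift del: add_0)
qed

lemma quad_trig_many_zeros:
  assumes "finite Z" "card Z \<ge> 2 * k + 3" "Z \<subseteq> {u..u + 2 * pi}"
    and z: "\<And>z. z \<in> Z \<Longrightarrow> quad_trig q b k \<alpha> \<beta> z = 0"
  shows "q = 0"
proof -
  have ne: "Z \<noteq> {}" using assms(2) by auto
  obtain Z' where Z': "finite Z'" "card Z = Suc (card Z')" "Z' \<subseteq> {Min Z<..<Max Z}"
    "\<And>z. z \<in> Z' \<Longrightarrow> quad_trig_deriv q b k \<alpha> \<beta> z = 0"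
    using rolle_zeros[OF has_derivative_quad_trig assms(1) ne z] by metis
  have "u \<le> Min Z" "Max Z \<le> u + 2 * pi"
    using assms(1,3) ne by (meson Min_in Max_in atLeastAtMost_iff subsetD)+
  then have "Z' \<subseteq> {u..u + 2 * pi}" using Z'(3) by fastforce
  then show ?thesis using quad_trig_deriv_many_zeros[OF Z'(1) _ _ Z'(4)] Z'(2) assms(2) by simp
qed

text \<open>Rolle gives at least \<open>2 * k + 1\<close> zeros of the derivative outside
  \<open>Z\<close>; the double zero \<open>w\<close>, which lies in \<open>Z\<close>, is one
  more.\<close>

lemma quad_trig_double_zero:
  assumes "finite Z" "card Z \<ge> 2 * k + 2" "Z \<subseteq> {u..u + 2 * pi}"
    and z: "\<And>z. z \<in> Z \<Longrightarrow> quad_trig q b k \<alpha> \<beta> z = 0"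
    and "w \<in> Z" "quad_trig_deriv q b k \<alpha> \<beta> w = 0"
  shows "q = 0"
proof -
  have ne: "Z \<noteq> {}" using assms(2) by auto
  obtain Z' where Z': "finite Z'" "card Z = Suc (card Z')" "Z' \<subseteq> {Min Z<..<Max Z}"
    "Z \<inter> Z' = {}" "\<And>z. z \<in> Z' \<Longrightarrow> quad_trig_deriv q b k \<alpha> \<beta> z = 0"
    using rolle_zeros[OF has_derivative_quad_trig assms(1) ne z] by metis
  have "u \<le> Min Z" "Max Z \<le> u + 2 * pi"
    using assms(1,3) ne by (meson Min_in Max_in atLeastAtMost_iff subsetD)+
  then have "insert w Z' \<subseteq> {u..u + 2 * pi}" using Z'(3) assms(3,5) by fastforce
  moreover have "w \<notin> Z'" using Z'(4) assms(5) by auto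
  ultimately show ?thesis
    using quad_trig_deriv_many_zeros[of "insert w Z'" k u q b \<alpha> \<beta>] Z' assms(2,6) by auto
qed

text \<open>Each simple zero reverses the sign. The induction removes the largest zero and cuts the
  interval just to its left.\<close>

lemma sign_simple_zeros:
  fixes f :: "real \<Rightarrow> real"
  assumes "finite S" "x \<le> y" "S \<subseteq> {x<..<y}"
    and "\<And>t. (f has_real_derivative f' t) (at t)"
    and "\<And>t. t \<in> {x..y} \<Longrightarrow> f t = 0 \<longleftrightarrow> t \<in> S"
    and "\<And>t. t \<in> S \<Longrightarrow> f' t \<noteq> 0"
  shows "f x * f y * (- 1) ^ card S > 0"
  using assms(1-3,5,6)
proof (induction S arbitrary: y rule: finite_linorder_max_induct)
  case empty
  have cont: "continuous_on {x..y} f"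
    using assms(4) by (meson DERIV_isCont continuous_at_imp_continuous_on)
  show ?case
  proof (rule ccontr)
    assume "\<not> ?thesis"
    then consider "f x \<le> 0" "0 \<le> f y" | "f y \<le> 0" "0 \<le> f x"
      by (auto simp: not_less mult_le_0_iff)
    then have "\<exists>t\<ge>x. t \<le> y \<and> f t = 0"
      by cases (use IVT'[of f x 0 y] IVT2'[of f y 0 x] cont empty.prems(1) in auto)
    then show False using empty.prems(3) by auto
  qed
next
  case (insert b A)
  have bxy: "x < b" "b < y" using insert.prems(2) by auto
  \<comment> \<open>Inserting \<open>x\<close> covers the case that \<open>b\<close> is the only
    zero.\<close>
  define l where "l = Max (insert x A)"
  have l: "x \<le> l" "l < b" "\<And>a. a \<in> A \<Longrightarrow> a \<le> l"
    using insert bxy by (auto simp: l_def)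
  define z where "z = (l + b) / 2"
  have z: "l < z" "z < b" using l by (auto simp: z_def)
  have "f x * f z * (- 1) ^ card A > 0"
  proof (rule insert.IH)
    show "A \<subseteq> {x<..<z}" using insert.prems(2) l z by force
    show "f t = 0 \<longleftrightarrow> t \<in> A" if "t \<in> {x..z}" for t
      using insert.prems(3)[of t] that z bxy by auto
  qed (use insert.prems(4) l z in auto)
  \<comment> \<open>Otherwise \<open>f z * f t\<close> would be positive on both sides of
    \<open>b\<close> and zero at \<open>b\<close>, a local minimum, so the derivative would vanish
    there.\<close>
  moreover have "f z * f y < 0"
  proof (rule ccontr)
    assume neg: "\<not> ?thesis"
    have nz: "f t \<noteq> 0" if "t \<in> {z..y}" "t \<noteq> b" for t
      using insert.prems(3)[of t] that z l by force
    have f0: "f b = 0" "f' b \<noteq> 0" using insert.prems(3,4)[of b] bxy by auto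
    have pos: "f z * f y > 0"
      using neg nz[of z] nz[of y] bxy z by (auto simp: not_less less_le)
    have same: "f z * f t > 0" if t: "t \<in> {z..y}" "t \<noteq> b" for t
    proof (rule ccontr)
      assume "\<not> ?thesis"
      then have ft: "f z * f t < 0" using nz[of z] nz[of t] t z bxy by (auto simp: not_less less_le)
      have cont: "continuous_on A f" for A
        using assms(4) by (meson DERIV_isCont continuous_at_imp_continuous_on)
      have ivt: "\<exists>w. p \<le> w \<and> w \<le> r \<and> f w = 0" if "f p * f r \<le> 0" "p \<le> r" for p r
      proof -
        from that consider "f p \<le> 0" "0 \<le> f r" | "f r \<le> 0" "0 \<le> f p"
          by (auto simp: mult_le_0_iff)
        then show ?thesis
          by cases (use IVT'[of f p 0 r] IVT2'[of f r 0 p] cont that(2) in auto)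
      qed
      show False
      proof (cases "t < b")
        case True
        then show False using ivt[of z t] ft t nz z bxy by force
      next
        case False
        have "f t * f y \<le> 0" using ft pos by (smt (verit) mult_less_0_iff zero_less_mult_iff)
        then show False using ivt[of t y] t nz z bxy False by force
      qed
    qed
    let ?d = "min (b - z) (y - b)"
    have d: "0 < ?d" using z bxy by auto
    have loc: "f z * f b \<le> f z * f t" if "\<bar>b - t\<bar> < ?d" for t
    proof (cases "t = b")
      case False
      have "t \<in> {z..y}" using that by (auto simp: abs_less_iff)
      from same[OF this False] show ?thesis using f0 by simp
    qed simp
    have "((\<lambda>t. f z * f t) has_real_derivative f z * f' b) (at b)"
      using assms(4) by (auto intro!: derivative_eq_intros)
    from DERIV_local_min[OF this d] loc have "f z * f' b = 0" by auto
    then show False using f0 nz[of z] z bxy by auto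
  qed
  moreover have "card (insert b A) = Suc (card A)"
    using insert by (metis card_insert_disjoint less_irrefl)
  ultimately show ?case
    by (simp add: zero_less_mult_iff mult_less_0_iff del: power_Suc) (auto simp: zero_less_mult_iff mult_less_0_iff)
qed

section \<open>Interpolation at paired lattice parameters\<close>

text \<open>The index is real rather than integral so that twins, which lie between lattice points,
  are covered too.\<close>

definition node :: "nat \<Rightarrow> real \<Rightarrow> real" where
  "node n x = 2 * pi * x / real n"

text \<open>The twin of the last parameter \<open>b\<close> lies on its left, so that all parameters stay in one
  closed period even when \<open>b\<close> is a full period after the first one. No lattice
  parameter lies between a parameter and its twin.\<close>
definition twin :: "int \<Rightarrow> int \<Rightarrow> real" where
  "twin b t = (if t < b then of_int t + 1 / 3 else of_int t - 1 / 3)"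

definition paired_nodes :: "nat \<Rightarrow> int \<Rightarrow> int set \<Rightarrow> real set" where
  "paired_nodes n b T = (\<lambda>t. node n (of_int t)) ` T \<union> (\<lambda>t. node n (twin b t)) ` T"

lemma node_less_iff [simp]: "n \<ge> 1 \<Longrightarrow> node n x < node n y \<longleftrightarrow> x < y"
  by (simp add: node_def divide_less_cancel)

lemma node_le_iff [simp]: "n \<ge> 1 \<Longrightarrow> node n x \<le> node n y \<longleftrightarrow> x \<le> y"
  by (simp add: node_def divide_le_cancel)

lemma node_eq_iff [simp]: "n \<ge> 1 \<Longrightarrow> node n x = node n y \<longleftrightarrow> x = y"
  by (simp add: node_def)

lemma node_add_period: "n \<ge> 1 \<Longrightarrow> node n (x + real n) = node n x + 2 * pi"
  by (simp add: node_def field_simps)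

lemma twin_neq_of_int: "twin b t \<noteq> of_int x"
proof
  assume "twin b t = of_int x"
  then have "of_int (3 * (x - t)) = (1 :: real) \<or> of_int (3 * (x - t)) = (- 1 :: real)"
    by (auto simp: twin_def split: if_splits)
  then have "3 * (x - t) = 1 \<or> 3 * (x - t) = - 1"
    by (metis of_int_1 of_int_eq_iff of_int_minus)
  then show False by presburger
qed

lemma inj_twin: "inj (twin b)"
proof
  fix x y assume "twin b x = twin b y"
  then have "of_int (3 * (x - y)) = (0 :: real) \<or> of_int (3 * (x - y)) = (2 :: real) \<or>
      of_int (3 * (x - y)) = (- 2 :: real)"
    by (auto simp: twin_def split: if_splits)
  then have "3 * (x - y) = 0 \<or> 3 * (x - y) = 2 \<or> 3 * (x - y) = - 2"
    by (metis of_int_0 of_int_numeral of_int_eq_iff of_int_minus)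
  then show "x = y" by presburger
qed

lemma twin_less_of_int_iff:
  assumes "x \<noteq> t" shows "twin b t < of_int x \<longleftrightarrow> t < x"
proof (cases "t < x")
  case True
  then have "of_int (t + 1) \<le> real_of_int x" by (subst of_int_le_iff) simp
  with True show ?thesis by (simp add: twin_def)
next
  case False
  with assms have "of_int (x + 1) \<le> real_of_int t" by (subst of_int_le_iff) simp
  with False show ?thesis by (simp add: twin_def)
qed

lemma of_int_less_twin_iff:
  assumes "x \<noteq> t" shows "of_int x < twin b t \<longleftrightarrow> x < t"
  using twin_less_of_int_iff[OF assms, of b] twin_neq_of_int[of b t x] assms by linarith

lemma finite_paired_nodes: "finite T \<Longrightarrow> finite (paired_nodes n b T)"
  by (simp add: paired_nodes_def)

lemma card_paired_nodes:
  assumes "n \<ge> 1" "finite T" shows "card (paired_nodes n b T) = 2 * card T"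
proof -
  have "card (paired_nodes n b T)
      = card ((\<lambda>t. node n (of_int t)) ` T) + card ((\<lambda>t. node n (twin b t)) ` T)"
    unfolding paired_nodes_def using assms twin_neq_of_int
    by (intro card_Un_disjoint) (auto, metis)
  moreover have "inj (\<lambda>t. node n (of_int t))" "inj (\<lambda>t. node n (twin b t))"
    using assms(1) inj_twin[of b] by (auto simp: inj_def)
  ultimately show ?thesis by (simp add: card_image inj_on_subset)
qed

section \<open>From positivity near one period to positivity on the whole lattice\<close>

lemma quad_trig_node_shift:
  assumes "n \<ge> 1"
  shows "quad_trig q B k \<alpha> \<beta> (node n (of_int (t + int n))) =
    quad_trig q B k \<alpha> \<beta> (node n (of_int t)) + (4 * pi * q * (2 * pi / n)) * of_int t
      + (4 * pi\<^sup>2 * q + 2 * pi * B)"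
  using quad_trig_shift[of q B k \<alpha> \<beta> "node n (of_int t)"] node_add_period[OF assms, of "of_int t"]
  by (simp add: node_def)

text \<open>The increment over \<open>n\<close> steps is strictly increasing and nonnegative at
  \<open>a\<close>, hence positive to the right of \<open>a\<close>. Induction in steps of
  \<open>n\<close> starts from the window where \<open>F\<close> is nonnegative.\<close>

lemma periodic_growth_above:
  fixes F :: "int \<Rightarrow> real"
  assumes "n > 0" "A > 0" and shift: "\<And>t. F (t + n) = F t + A * of_int t + B"
    and "F a = 0" "b \<le> a + n" and nonneg: "\<And>t. t \<in> {b - n..a + n} \<Longrightarrow> F t \<ge> 0"
    and "t > a + n"
  shows "F t > 0"
  using assms(7)
proof (induction "nat (t - a)" arbitrary: t rule: less_induct)
  case less
  have F: "F t = F (t - n) + A * of_int (t - n) + B" using shift[of "t - n"] by simp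
  have "F (t - n) \<ge> 0"
  proof (cases "t - n > a + n")
    case True
    then show ?thesis using less.hyps[of "t - n"] assms(1) by fastforce
  next
    case False
    then show ?thesis using less.prems assms(1,5) by (intro nonneg) auto
  qed
  moreover have "A * of_int (t - n) > A * of_int a" using less.prems assms(2) by auto
  \<comment> \<open>This is \<open>F (a + n) - F a\<close>, and \<open>F a = 0\<close>.\<close>
  moreover have "A * of_int a + B \<ge> 0"
    using shift[of a] assms(1,4,5) nonneg[of "a + n"] by simp
  ultimately show ?case using F by linarith
qed

lemma periodic_growth:
  fixes F :: "int \<Rightarrow> real"
  assumes "n > 0" "A > 0" and shift: "\<And>t. F (t + n) = F t + A * of_int t + B"
    and "F a = 0" "F b = 0" "b \<le> a + n"
    and nonneg: "\<And>t. t \<in> {b - n..a + n} \<Longrightarrow> F t \<ge> 0" and "t \<notin> {b - n..a + n}"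
  shows "F t > 0"
proof (cases "t > a + n")
  case True
  then show ?thesis using periodic_growth_above[OF assms(1-3) assms(4,6) nonneg] by blast
next
  case False
  let ?F = "\<lambda>t. F (- t)"
  have "?F (- t) > 0"
  \<comment> \<open>Reflection keeps the slope of the increment, changes its constant term, and
    exchanges the roles of \<open>a\<close> and \<open>b\<close>.\<close>
  proof (rule periodic_growth_above[of n A ?F "A * of_int n - B" "- b" "- a"])
    show "F (- (t + n)) = F (- t) + A * of_int t + (A * of_int n - B)" for t
      using shift[of "- (t + n)"] by (simp add: algebra_simps)
    show "F (- t) \<ge> 0" if "t \<in> {- a - n..- b + n}" for t
      using that by (intro nonneg) auto
  qed (use assms False in auto)
  then show ?thesis by simp
qed

section \<open>Position of the paired parameters within one period\<close>

locale node_window =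
  fixes k n :: nat and J :: "int set" and a b :: int
  assumes n: "n \<ge> 1" and k: "k \<ge> 1" and finJ: "finite J" and cardJ: "card J = k + 1"
    and ends: "a \<in> J" "b \<in> J" and J_range: "\<And>t. t \<in> J \<Longrightarrow> a \<le> t \<and> t \<le> b"
    and width: "b \<le> a + int n"
begin

abbreviation "S \<equiv> paired_nodes n b J"

text \<open>Since \<open>k \<ge> 1\<close>, there are at least two chosen indices. Hence the twin of
  \<open>b\<close>, lying to its left, does not fall below \<open>a\<close>.\<close>

lemma a_less_b: "a < b"
proof (rule ccontr)
  assume "\<not> a < b"
  then have "J \<subseteq> {a}" using J_range by force
  then have "card J \<le> card {a}" by (intro card_mono) auto
  then show False using cardJ k by simp
qed

lemma node_ab: "node n (of_int (a + int n)) = node n (of_int a) + 2 * pi"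
  "node n (of_int (b - int n)) = node n (of_int b) - 2 * pi"
  using node_add_period[OF n, of "of_int a"] node_add_period[OF n, of "of_int b - real n"] by auto

lemma S_range: "s \<in> S \<Longrightarrow> node n (of_int a) \<le> s \<and> s \<le> node n (of_int b)"
proof -
  assume "s \<in> S"
  then obtain t where t: "t \<in> J" and s: "s = node n (of_int t) \<or> s = node n (twin b t)"
    by (auto simp: paired_nodes_def)
  have "of_int (a + 1) \<le> real_of_int b" using a_less_b by (subst of_int_le_iff) simp
  moreover have "of_int (t + 1) \<le> real_of_int b" if "t < b" using that by (subst of_int_le_iff) simp
  ultimately have "of_int a \<le> twin b t \<and> twin b t \<le> of_int b"
    using J_range[OF t] by (auto simp: twin_def)
  then show ?thesis using s n J_range[OF t] by auto
qed

lemma finS: "finite S" and cardS: "card S = 2 * k + 2"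
  using finJ n cardJ by (auto simp: card_paired_nodes finite_paired_nodes)

text \<open>Two closed periods containing \<open>S\<close>, one starting at \<open>a\<close> and one
  ending at \<open>b\<close>. Together they cover all parameters from index \<open>b - n\<close> to
  \<open>a + n\<close>, so any further zero there shares a period with all of
  \<open>S\<close>.\<close>

lemma S_window: "S \<subseteq> {node n (of_int a)..node n (of_int a) + 2 * pi}"
  "S \<subseteq> {node n (of_int b) - 2 * pi..node n (of_int b) - 2 * pi + 2 * pi}"
proof -
  have "node n (of_int b) \<le> node n (of_int (a + int n))"
    unfolding node_le_iff[OF n] of_int_le_iff by (rule width)
  then show "S \<subseteq> {node n (of_int a)..node n (of_int a) + 2 * pi}"
    "S \<subseteq> {node n (of_int b) - 2 * pi..node n (of_int b) - 2 * pi + 2 * pi}"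
    unfolding node_ab using S_range by force+
qed

lemma node_in_S_iff: "node n (of_int t) \<in> S \<longleftrightarrow> t \<in> J"
  using n twin_neq_of_int by (auto simp: paired_nodes_def) metis

text \<open>A cut at an unchosen lattice point never separates a parameter from its twin, so only
  whole pairs remain.\<close>

lemma paired_below:
  assumes "p \<notin> J" shows "S \<inter> {..node n (of_int p)} = paired_nodes n b (J \<inter> {..<p})"
proof -
  have "node n (of_int t) \<in> {..node n (of_int p)} \<longleftrightarrow> t \<in> {..<p}"
    "node n (twin b t) \<in> {..node n (of_int p)} \<longleftrightarrow> t \<in> {..<p}" if "t \<in> J" for t
    using n that assms twin_less_of_int_iff[of p t b] twin_neq_of_int[of b t p] by (auto simp: less_le)
  then show ?thesis unfolding paired_nodes_def by blast
qed

lemma paired_above: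
  assumes "p \<notin> J" shows "S \<inter> {node n (of_int p)..} = paired_nodes n b (J \<inter> {p<..})"
proof -
  have "node n (of_int t) \<in> {node n (of_int p)..} \<longleftrightarrow> t \<in> {p<..}"
    "node n (twin b t) \<in> {node n (of_int p)..} \<longleftrightarrow> t \<in> {p<..}" if "t \<in> J" for t
    using n that assms of_int_less_twin_iff[of p t b] twin_neq_of_int[of b t p] by (auto simp: less_le)
  then show ?thesis unfolding paired_nodes_def by blast
qed

lemma even_card_between:
  assumes "x \<notin> J" "y \<notin> J"
  shows "even (card (S \<inter> {node n (of_int x)..node n (of_int y)}))"
proof -
  have "node n (of_int t) \<in> {node n (of_int x)..node n (of_int y)} \<longleftrightarrow> t \<in> {x<..<y}"
    "node n (twin b t) \<in> {node n (of_int x)..node n (of_int y)} \<longleftrightarrow> t \<in> {x<..<y}" if "t \<in> J" for t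
    using n that assms twin_less_of_int_iff[of y t b] twin_neq_of_int[of b t y]
      of_int_less_twin_iff[of x t b] twin_neq_of_int[of b t x] by (auto simp: less_le)
  then have "S \<inter> {node n (of_int x)..node n (of_int y)} = paired_nodes n b (J \<inter> {x<..<y})"
    unfolding paired_nodes_def by blast
  then show ?thesis using n finJ by (simp add: card_paired_nodes)
qed

end

section \<open>Sign pattern of a function vanishing at the paired parameters\<close>

locale paired_zeros = node_window +
  fixes B :: real and \<alpha> \<beta> :: "nat \<Rightarrow> real"
  assumes zeros: "\<And>s. s \<in> paired_nodes n b J \<Longrightarrow> quad_trig 1 B k \<alpha> \<beta> s = 0"
begin

abbreviation "f \<equiv> quad_trig 1 B k \<alpha> \<beta>"
abbreviation "f' \<equiv> quad_trig_deriv 1 B k \<alpha> \<beta>"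
abbreviation "F t \<equiv> f (node n (of_int t))"

text \<open>One more zero would make \<open>2 * k + 3\<close> in a closed period, which forces the
  leading coefficient to be 0, whereas it is 1.\<close>

lemma zero_iff:
  assumes "s \<in> {node n (of_int (b - int n))..node n (of_int (a + int n))}"
  shows "f s = 0 \<longleftrightarrow> s \<in> S"
proof
  assume fs: "f s = 0"
  show "s \<in> S"
  proof (rule ccontr)
    assume "s \<notin> S"
    then have c: "card (insert s S) \<ge> 2 * k + 3" using finS cardS by simp
    have "node n (of_int a) \<le> node n (of_int b)" using n a_less_b by simp
    then have "insert s S \<subseteq> {node n (of_int a)..node n (of_int a) + 2 * pi} \<or>
        insert s S \<subseteq> {node n (of_int b) - 2 * pi..node n (of_int b) - 2 * pi + 2 * pi}"
      using S_window assms unfolding node_ab by (cases "node n (of_int a) \<le> s") auto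
    moreover have "\<not> insert s S \<subseteq> {u..u + 2 * pi}" for u
      using quad_trig_many_zeros[OF _ c, of u 1 B \<alpha> \<beta>] finS fs zeros by auto
    ultimately show False by blast
  qed
qed (rule zeros)

lemma deriv_nonzero: "s \<in> S \<Longrightarrow> f' s \<noteq> 0"
  using quad_trig_double_zero[OF finS _ S_window(1) zeros, of s] cardS by auto

lemma sign:
  assumes "x \<le> y" "node n (of_int (b - int n)) \<le> x" "y \<le> node n (of_int (a + int n))"
    and "x \<notin> S" "y \<notin> S"
  shows "f x * f y * (- 1) ^ card (S \<inter> {x..y}) > 0"
proof (rule sign_simple_zeros[where f = f and f' = f' and S = "S \<inter> {x..y}"])
  show "S \<inter> {x..y} \<subseteq> {x<..<y}" using assms(4,5) by (force simp: less_le)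
  show "f s = 0 \<longleftrightarrow> s \<in> S \<inter> {x..y}" if "s \<in> {x..y}" for s
    using zero_iff[of s] assms that by auto
qed (use assms finS deriv_nonzero in \<open>auto intro: has_derivative_quad_trig\<close>)

lemma same_sign:
  assumes "x \<in> {b - int n..a + int n} - J" "y \<in> {b - int n..a + int n} - J"
  shows "F x * F y > 0"
proof -
  have *: "F x * F y > 0"
    if "x \<le> y" "x \<in> {b - int n..a + int n} - J" "y \<in> {b - int n..a + int n} - J" for x y
  proof -
    have le: "real_of_int x \<le> real_of_int y" "real_of_int (b - int n) \<le> real_of_int x"
      "real_of_int y \<le> real_of_int (a + int n)"
      using that by (simp_all only: of_int_le_iff Diff_iff atLeastAtMost_iff)
    have "F x * F y * (- 1) ^ card (S \<inter> {node n (of_int x)..node n (of_int y)}) > 0"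
      using that le by (intro sign) (simp_all only: node_le_iff[OF n] node_in_S_iff Diff_iff not_False_eq_True)
    then show ?thesis using even_card_between[of x y] that by simp
  qed
  then show ?thesis using *[of x y] *[of y x] assms by (cases "x \<le> y") (auto simp: mult.commute)
qed

text \<open>Between \<open>p\<close> and a point \<open>x\<close> just inside an end of the window
  lie whole pairs, except that the end point \<open>e\<close> itself is cut off. The number of sign
  changes is therefore odd.\<close>

lemma opposite_sign_near_ends:
  assumes "p \<notin> J" "a < p" "p < b" and e: "e = a \<or> e = b"
    and x: "x \<notin> S" "\<And>s. s \<in> S \<Longrightarrow> s \<noteq> node n (of_int e) \<Longrightarrow> \<bar>x - node n (of_int e)\<bar> < \<bar>s - node n (of_int e)\<bar>"
    and "node n (of_int a) < x" "x < node n (of_int b)"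
  shows "f x * F p < 0"
proof -
  have bd: "node n (of_int (b - int n)) \<le> node n (of_int a)" "node n (of_int b) \<le> node n (of_int (a + int n))"
    unfolding node_le_iff[OF n] of_int_le_iff using width by simp_all
  have p: "node n (of_int p) \<notin> S" using assms(1) node_in_S_iff by simp
  have np: "node n (of_int a) < node n (of_int p)" "node n (of_int p) < node n (of_int b)"
    using n assms by auto
  have eS: "node n (of_int e) \<in> S" using e node_in_S_iff ends by auto
  have odd: "(- 1 :: real) ^ card (paired_nodes n b T - {node n (of_int e)}) = - 1" if "T \<subseteq> J" "e \<in> T" for T
  proof -
    have fT: "finite T" using that finJ finite_subset by blast
    have "card T > 0" using that fT card_gt_0_iff by blast
    moreover have "node n (of_int e) \<in> paired_nodes n b T" using that by (auto simp: paired_nodes_def)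
    ultimately show ?thesis using n fT
      by (auto simp: card_paired_nodes uminus_power_if)
  qed
  have twin_in_S: "node n (twin b t) \<in> S" if "t \<in> J" for t
    using that by (auto simp: paired_nodes_def)
  have twin_ends: "of_int a < twin b a" "twin b b < of_int b"
    using a_less_b by (simp_all add: twin_def)
  from e show ?thesis
  proof
    assume e: "e = a"
    have tw: "node n (twin b a) \<in> S" "node n (twin b a) < node n (of_int p)" "node n (of_int a) < node n (twin b a)"
      using twin_in_S[OF ends(1)] n twin_less_of_int_iff[of p a b] assms(2) twin_ends by simp_all
    have xp: "x < node n (of_int p)" using x(2)[OF tw(1)] tw e assms(7) by auto
    \<comment> \<open>As \<open>x\<close> is nearer to \<open>e\<close> than any other zero,
      \<open>e\<close> is the only zero to its left.\<close>
    have "S \<inter> {x..node n (of_int p)} = (S \<inter> {..node n (of_int p)}) - {node n (of_int e)}"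
      using x(2) assms(7) S_range unfolding e by fastforce
    also have "\<dots> = paired_nodes n b (J \<inter> {..<p}) - {node n (of_int e)}"
      using paired_below[OF assms(1)] by simp
    finally have "(- 1 :: real) ^ card (S \<inter> {x..node n (of_int p)}) = - 1"
      using odd[of "J \<inter> {..<p}"] e ends assms by simp
    then show ?thesis using sign[of x "node n (of_int p)"] xp x(1) p np assms(7) bd by auto
  next
    assume e: "e = b"
    have tw: "node n (twin b b) \<in> S" "node n (of_int p) < node n (twin b b)" "node n (twin b b) < node n (of_int b)"
      using twin_in_S[OF ends(2)] n of_int_less_twin_iff[of p b b] assms(3) twin_ends by simp_all
    have xp: "node n (of_int p) < x" using x(2)[OF tw(1)] tw e assms(8) by auto
    have "S \<inter> {node n (of_int p)..x} = (S \<inter> {node n (of_int p)..}) - {node n (of_int e)}"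
      using x(2) assms(8) S_range unfolding e by fastforce
    also have "\<dots> = paired_nodes n b (J \<inter> {p<..}) - {node n (of_int e)}"
      using paired_above[OF assms(1)] by simp
    finally have "(- 1 :: real) ^ card (S \<inter> {node n (of_int p)..x}) = - 1"
      using odd[of "J \<inter> {p<..}"] e ends assms by simp
    then show ?thesis using sign[of "node n (of_int p)" x] xp x(1) p np assms(8) bd by (auto simp: mult.commute)
  qed
qed

text \<open>Here \<open>a + n\<close> and \<open>b - n\<close> are unchosen, so \<open>F\<close>
  would be negative at both. Then the increasing increment over one period would be negative at
  \<open>a\<close> and positive at \<open>b - n\<close>, although \<open>b - n < a\<close>.\<close>

lemma positive_gap_narrow:
  assumes p: "p \<in> {b - int n..a + int n} - J" and "b < a + int n" "F p < 0"
  shows False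
proof -
  have Fa: "F a = 0" "F b = 0" using zeros ends by (auto simp: paired_nodes_def)
  have "a + int n \<in> {b - int n..a + int n} - J" "b - int n \<in> {b - int n..a + int n} - J"
    using J_range[of "a + int n"] J_range[of "b - int n"] assms(2) by force+
  from this[THEN same_sign[OF p]] have "F (a + int n) < 0" "F (b - int n) < 0"
    using assms(3) by (auto simp: zero_less_mult_iff)
  moreover have "f (node n (of_int (a + int n))) = 4 * pi * node n (of_int a) + (4 * pi\<^sup>2 + 2 * pi * B)"
    unfolding node_ab(1) using quad_trig_shift[of 1 B k \<alpha> \<beta> "node n (of_int a)"] Fa by simp
  moreover have "f (node n (of_int (b - int n))) =
      - (4 * pi * node n (of_int (b - int n)) + (4 * pi\<^sup>2 + 2 * pi * B))"
    using quad_trig_shift[of 1 B k \<alpha> \<beta> "node n (of_int (b - int n))"] Fa node_ab(2) by simp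
  ultimately have "4 * pi * node n (of_int a) < 4 * pi * node n (of_int (b - int n))" by linarith
  then have "node n (of_int a) < node n (of_int (b - int n))" by simp
  then have "real_of_int a < real_of_int (b - int n)" by (simp only: node_less_iff[OF n])
  then show False using assms(2) by simp
qed

text \<open>Now \<open>a + n\<close> and \<open>b - n\<close> are themselves chosen, so derivatives
  at the ends are compared instead. If \<open>F p\<close> were negative, \<open>f\<close> would be
  positive just inside both ends, giving \<open>f'\<close> nonnegative at \<open>a\<close> and
  nonpositive at \<open>b\<close>; but \<open>f'\<close> grows by \<open>4 * pi\<close> over the
  period.\<close>

lemma positive_gap_wide:
  assumes p: "p \<in> {b - int n..a + int n} - J" and ban: "b = a + int n" and neg: "F p < 0"
  shows False
proof -
  let ?a = "node n (of_int a)" and ?b = "node n (of_int b)"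
  have Fa: "f ?a = 0" "f ?b = 0" using zeros ends by (auto simp: paired_nodes_def)
  have "p \<noteq> a" "p \<noteq> b" using p ends by auto
  then have pab: "p \<notin> J" "a < p" "p < b" using p ban by auto
  have ab: "?a < ?b" using n a_less_b by simp
  \<comment> \<open>A radius around either end that isolates it from the other zeros.\<close>
  obtain d where d: "d > 0" "\<And>s e. e = a \<or> e = b \<Longrightarrow> s \<in> S \<Longrightarrow> s \<noteq> node n (of_int e) \<Longrightarrow> d \<le> \<bar>s - node n (of_int e)\<bar>"
  proof -
    obtain d1 where d1: "d1 > 0" "\<forall>s\<in>S. s \<noteq> ?a \<longrightarrow> d1 \<le> dist ?a s"
      using finite_set_avoid[OF finS] by blast
    obtain d2 where d2: "d2 > 0" "\<forall>s\<in>S. s \<noteq> ?b \<longrightarrow> d2 \<le> dist ?b s"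
      using finite_set_avoid[OF finS] by blast
    show ?thesis
      using d1 d2 by (intro that[of "min d1 d2"]) (auto simp: dist_real_def abs_minus_commute min_le_iff_disj)
  qed
  have aS: "?a \<in> S" "?b \<in> S" using ends node_in_S_iff by auto
  have dab: "d \<le> ?b - ?a" using d(2)[of b ?a] ab aS by auto
  have pos_a: "f (?a + h) > 0" if h: "0 < h" "h < d" for h
  proof -
    have "?a + h \<notin> S" using d(2)[of a "?a + h"] h by auto
    moreover have "\<bar>?a + h - ?a\<bar> < \<bar>s - ?a\<bar>" if "s \<in> S" "s \<noteq> ?a" for s
      using d(2)[of a s] that h by auto
    ultimately have "f (?a + h) * F p < 0"
      using opposite_sign_near_ends[OF pab, of a "?a + h"] h dab by auto
    then show ?thesis using neg by (auto simp: mult_less_0_iff)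
  qed
  have pos_b: "f (?b - h) > 0" if h: "0 < h" "h < d" for h
  proof -
    have "?b - h \<notin> S" using d(2)[of b "?b - h"] h by auto
    moreover have "\<bar>?b - h - ?b\<bar> < \<bar>s - ?b\<bar>" if "s \<in> S" "s \<noteq> ?b" for s
      using d(2)[of b s] that h by auto
    ultimately have "f (?b - h) * F p < 0"
      using opposite_sign_near_ends[OF pab, of b "?b - h"] h dab by auto
    then show ?thesis using neg by (auto simp: mult_less_0_iff)
  qed
  have "f' ?a \<ge> 0"
  proof (rule ccontr)
    assume "\<not> ?thesis"
    then obtain r where r: "r > 0" "\<And>h. 0 < h \<Longrightarrow> h < r \<Longrightarrow> f (?a + h) < 0"
      using DERIV_neg_dec_right[OF has_derivative_quad_trig, of 1 B k \<alpha> \<beta> ?a] Fa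
      by (auto simp: not_le)
    define h where "h = min r d / 2"
    have "0 < h" "h < r" "h < d" using r(1) d(1) by (auto simp: h_def min_def)
    then show False using r(2)[of h] pos_a[of h] by auto
  qed
  moreover have "f' ?b \<le> 0"
  proof (rule ccontr)
    assume "\<not> ?thesis"
    then obtain r where r: "r > 0" "\<And>h. 0 < h \<Longrightarrow> h < r \<Longrightarrow> f (?b - h) < 0"
      using DERIV_pos_inc_left[OF has_derivative_quad_trig, of 1 B k \<alpha> \<beta> ?b] Fa
      by (auto simp: not_le)
    define h where "h = min r d / 2"
    have "0 < h" "h < r" "h < d" using r(1) d(1) by (auto simp: h_def min_def)
    then show False using r(2)[of h] pos_b[of h] by auto
  qed
  moreover have "f' ?b = f' ?a + 4 * pi"
    using quad_trig_deriv_shift[of 1 B k \<alpha> \<beta> ?a] node_ab(1) ban by simp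
  ultimately show False using pi_gt_zero by linarith
qed

lemma positive_gap:
  assumes p: "p \<in> {b - int n..a + int n} - J"
  shows "F p > 0"
proof (rule ccontr)
  assume "\<not> F p > 0"
  moreover have "F p * F p > 0" using same_sign[OF p p] .
  ultimately have "F p < 0" by (simp add: not_less less_le)
  then show False
    using positive_gap_narrow[OF p] positive_gap_wide[OF p] width by linarith
qed

lemma positive:
  assumes "t \<notin> J"
  shows "F t > 0"
proof (cases "t \<in> {b - int n..a + int n}")
  case True
  then show ?thesis using assms by (intro positive_gap) auto
next
  case False
  have zJ: "F t = 0" if "t \<in> J" for t
    using that zeros by (auto simp: paired_nodes_def)
  show ?thesis
  proof (rule periodic_growth[of "int n" "4 * pi * 1 * (2 * pi / n)" F "4 * pi\<^sup>2 * 1 + 2 * pi * B" a b])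
    show "F (t + int n) = F t + 4 * pi * 1 * (2 * pi / n) * of_int t + (4 * pi\<^sup>2 * 1 + 2 * pi * B)" for t
      by (rule quad_trig_node_shift[OF n])
    show "F s \<ge> 0" if "s \<in> {b - int n..a + int n}" for s
      using zJ[of s] positive_gap[of s] that by (cases "s \<in> J") auto
  qed (use n False zJ ends width in auto)
qed

end

section \<open>Spheres through helix points and Voronoi regions\<close>

lemma voronoi_region_image:
  assumes "bij f" "\<And>x y. dist (f x) (f y) = dist x y" "f ` S = S"
  shows "f ` voronoi_region S p = voronoi_region S (f p)"
proof -
  have "f x \<in> voronoi_region S (f p) \<longleftrightarrow> x \<in> voronoi_region S p" for x
  proof -
    have "f x \<in> voronoi_region S (f p) \<longleftrightarrow> (\<forall>q\<in>f ` S. dist (f x) (f p) \<le> dist (f x) q)"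
      using assms(3) by (simp add: voronoi_region_def)
    then show ?thesis by (simp add: assms(2) voronoi_region_def)
  qed
  then have "f -` voronoi_region S (f p) = voronoi_region S p" by auto
  then show ?thesis using surj_image_vimage_eq[OF bij_is_surj[OF assms(1)]] by metis
qed

lemma dist_le_dist_iff:
  fixes x p q :: "'a::euclidean_space"
  shows "dist x p \<le> dist x q \<longleftrightarrow> (2 *\<^sub>R (q - p)) \<bullet> x \<le> q \<bullet> q - p \<bullet> p"
proof -
  have "dist x p \<le> dist x q \<longleftrightarrow> (dist x p)\<^sup>2 \<le> (dist x q)\<^sup>2" by simp
  also have "\<dots> \<longleftrightarrow> (2 *\<^sub>R (q - p)) \<bullet> x \<le> q \<bullet> q - p \<bullet> p"
    by (simp add: dist_norm power2_norm_eq_inner inner_diff inner_commute algebra_simps)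
  finally show ?thesis .
qed

lemma dist_eq_dist_iff:
  fixes x p q :: "'a::euclidean_space"
  shows "dist x p = dist x q \<longleftrightarrow> (2 *\<^sub>R (q - p)) \<bullet> x = q \<bullet> q - p \<bullet> p"
  using dist_le_dist_iff[of x p q] dist_le_dist_iff[of x q p]
  unfolding order_eq_iff by (simp add: inner_diff_left algebra_simps)

text \<open>A direction \<open>w\<close> is admissible exactly when all
  \<open>p j \<bullet> w\<close> equal a common value \<open>- r\<close>, that is, when
  \<open>(r, w)\<close> is orthogonal to the lifted points. Their independence gives the dimension
  of this orthogonal complement, and projecting to \<open>w\<close> is injective because
  \<open>w\<close> determines \<open>r\<close>.\<close>

lemma dim_equidistant_directions:
  fixes p :: "'i \<Rightarrow> 'a::euclidean_space"
  assumes "finite J" "J \<noteq> {}"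
    and "independent ((\<lambda>j. (1 :: real, p j)) ` J)" "inj_on (\<lambda>j. (1 :: real, p j)) J"
  shows "dim {w. \<forall>i\<in>J. \<forall>j\<in>J. (p i - p j) \<bullet> w = 0} + card J = DIM('a) + 1"
proof -
  let ?L = "(\<lambda>j. (1 :: real, p j)) ` J"
  define U where "U = {y :: real \<times> 'a. \<forall>x\<in>?L. orthogonal x y}"
  have sub: "subspace U" unfolding U_def orthogonal_def
    by (auto simp: subspace_def inner_add_right)
  have "U = {y \<in> UNIV. \<forall>x\<in>span ?L. orthogonal x y}"
    unfolding U_def by (auto intro: orthogonal_to_span span_base simp: orthogonal_commute)
  moreover have "dim {y \<in> UNIV. \<forall>x\<in>span ?L. orthogonal x y} + dim (span ?L) = dim (UNIV :: (real \<times> 'a) set)"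
    by (rule dim_subspace_orthogonal_to_vectors) auto
  moreover have "dim (span ?L) = card J"
    using assms by (simp add: dim_eq_card_independent card_image)
  ultimately have U: "dim U + card J = DIM('a) + 1" by simp
  have eqU: "(r, w) \<in> U \<longleftrightarrow> (\<forall>j\<in>J. p j \<bullet> w = - r)" for r w
    by (auto simp: U_def orthogonal_def inner_Pair eq_neg_iff_add_eq_0 add.commute)
  have "inj_on snd U"
    using assms(2) by (auto simp: inj_on_def eqU)
  then have dimU: "dim (snd ` U) = dim U"
    using sub by (intro dim_image_eq) (auto simp: linear_snd span_eq_iff[THEN iffD2])
  have eq: "snd ` U = {w. \<forall>i\<in>J. \<forall>j\<in>J. (p i - p j) \<bullet> w = 0}"
  proof (intro equalityI subsetI)
    fix w assume w: "w \<in> {w. \<forall>i\<in>J. \<forall>j\<in>J. (p i - p j) \<bullet> w = 0}"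
    obtain i where "i \<in> J" using assms(2) by blast
    have "p j \<bullet> w = p i \<bullet> w" if "j \<in> J" for j
    proof -
      have "(p j - p i) \<bullet> w = 0" using w \<open>i \<in> J\<close> that by blast
      then show ?thesis by (simp add: inner_diff_left)
    qed
    then have "(- (p i \<bullet> w), w) \<in> U" unfolding eqU minus_minus by blast
    then show "w \<in> snd ` U" by (metis image_eqI snd_conv)
  qed (auto simp: eqU inner_diff_left)
  show ?thesis unfolding eq[symmetric] dimU by (rule U)
qed

text \<open>The intersection lies in the affine space of points equidistant from the chosen sites,
  and it contains a neighbourhood of \<open>c\<close> in that space because all other sites are
  farther from \<open>c\<close> by a uniform margin.\<close>

lemma aff_dim_voronoi_Inter:
  fixes p :: "'i \<Rightarrow> 'a::euclidean_space"
  assumes J: "finite J" "J \<noteq> {}"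
    and ind: "independent ((\<lambda>j. (1 :: real, p j)) ` J)" "inj_on (\<lambda>j. (1 :: real, p j)) J"
    and c: "\<And>j. j \<in> J \<Longrightarrow> dist c (p j) = r"
    and d: "\<delta> > 0" "\<And>i. i \<notin> J \<Longrightarrow> dist c (p i) \<ge> r + 2 * \<delta>"
  shows "aff_dim (\<Inter>j\<in>J. voronoi_region (range p) (p j)) = int DIM('a) - int (card J) + 1"
proof -
  let ?V = "\<Inter>j\<in>J. voronoi_region (range p) (p j)"
  define W where "W = {w. \<forall>i\<in>J. \<forall>j\<in>J. (p i - p j) \<bullet> w = 0}"
  \<comment> \<open>The inequality in both orders amounts to equidistance.\<close>
  define A where "A = {x. \<forall>i\<in>J. \<forall>j\<in>J. dist x (p i) \<le> dist x (p j)}"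
  have subW: "subspace W" unfolding W_def by (auto simp: subspace_def inner_add_right)
  have "c + w \<in> A \<longleftrightarrow> w \<in> W" for w
  proof -
    have "dist (c + w) (p i) \<le> dist (c + w) (p j) \<longleftrightarrow> 0 \<le> (p i - p j) \<bullet> w" if "i \<in> J" "j \<in> J" for i j
      using dist_eq_dist_iff[of c "p i" "p j"] c that
      by (simp add: dist_le_dist_iff inner_add_right inner_diff_left)
    then have *: "c + w \<in> A \<longleftrightarrow> (\<forall>i\<in>J. \<forall>j\<in>J. 0 \<le> (p i - p j) \<bullet> w)"
      unfolding A_def by blast
    have "(p i - p j) \<bullet> w = 0" if "\<forall>i\<in>J. \<forall>j\<in>J. 0 \<le> (p i - p j) \<bullet> w" "i \<in> J" "j \<in> J" for i j
    proof -
      have "0 \<le> (p i - p j) \<bullet> w" "0 \<le> (p j - p i) \<bullet> w" using that by blast+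
      then show ?thesis by (simp add: inner_diff_left)
    qed
    then show ?thesis unfolding * W_def by fastforce
  qed
  then have A: "A = (+) c ` W"
    by (auto simp: image_iff) (metis add.commute diff_add_cancel)
  have dimA: "aff_dim A = int DIM('a) - int (card J) + 1"
    using dim_equidistant_directions[OF J ind] unfolding A aff_dim_translation_eq W_def[symmetric]
    using subW by (simp add: aff_dim_subspace)
  have "convex A" unfolding A using subW by (simp add: convex_translation subspace_imp_convex)
  moreover have "c \<in> A" using c by (simp add: A_def)
  ultimately have "aff_dim (A \<inter> ball c \<delta>) = aff_dim A"
    using d(1) by (intro aff_dim_convex_Int_open) auto
  moreover have "aff_dim ?V \<le> aff_dim A"
    by (intro aff_dim_subset) (auto simp: A_def voronoi_region_def)
  moreover have "A \<inter> ball c \<delta> \<subseteq> ?V"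
  proof
    fix x assume x: "x \<in> A \<inter> ball c \<delta>"
    have "dist x (p j) \<le> dist x (p i)" if "j \<in> J" for i j
    proof (cases "i \<in> J")
      case True
      then show ?thesis using x that by (auto simp: A_def)
    next
      case False
      \<comment> \<open>Moving from \<open>c\<close> to \<open>x\<close> changes either distance by
        at most \<delta>, so a margin of twice that suffices.\<close>
      have "dist x (p j) \<le> r + \<delta>" "dist c (p i) \<le> dist x (p i) + \<delta>"
        using x c[OF that] dist_triangle[of x "p j" c] dist_triangle[of c "p i" x]
        by (auto simp: dist_commute)
      with d(2)[OF False] show ?thesis by simp
    qed
    then show "x \<in> ?V" by (auto simp: voronoi_region_def)
  qed
  then have "aff_dim (A \<inter> ball c \<delta>) \<le> aff_dim ?V" by (rule aff_dim_subset)
  ultimately show ?thesis using dimA by simp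
qed

section \<open>Coordinates, affine functionals and distances along the helix\<close>

locale helix =
  fixes k :: nat and e :: "nat \<Rightarrow> 'n::finite"
  assumes e: "bij_betw e {..2 * k} UNIV"
begin

definition of_coords :: "real \<Rightarrow> (nat \<Rightarrow> real) \<Rightarrow> (nat \<Rightarrow> real) \<Rightarrow> real ^ 'n" where
  "of_coords a b c = a *\<^sub>R axis (e 0) 1 +
     (\<Sum>j=1..k. b j *\<^sub>R axis (e (2 * j - 1)) 1 + c j *\<^sub>R axis (e (2 * j)) 1)"

abbreviation "h \<equiv> gen_helix k e"

lemma helix_of_coords: "h t = of_coords t (\<lambda>j. cos (real j * t)) (\<lambda>j. sin (real j * t))"
  by (simp add: gen_helix_def of_coords_def)

lemma card_index: "CARD('n) = 2 * k + 1"
  using bij_betw_same_card[OF e] by simp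

lemma e_eq_iff: "i \<le> 2 * k \<Longrightarrow> j \<le> 2 * k \<Longrightarrow> e i = e j \<longleftrightarrow> i = j"
  using e by (auto simp: bij_betw_def inj_on_def)

lemma inner_of_coords:
  "x \<bullet> of_coords a b c = a * x $ e 0 + (\<Sum>j=1..k. b j * x $ e (2 * j - 1) + c j * x $ e (2 * j))"
  unfolding of_coords_def by (simp add: inner_add_right inner_sum_right inner_axis)

lemma of_coords_nth [simp]:
  "of_coords a b c $ e 0 = a"
  "i \<in> {1..k} \<Longrightarrow> of_coords a b c $ e (2 * i - Suc 0) = b i"
  "i \<in> {1..k} \<Longrightarrow> of_coords a b c $ e (2 * i) = c i"
proof -
  have *: "of_coords a b c $ e i = (if i = 0 then a else 0) +
     (\<Sum>j=1..k. (if i = 2 * j - 1 then b j else 0) + (if i = 2 * j then c j else 0))" if "i \<le> 2 * k" for i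
  proof -
    have "(\<Sum>j=1..k. b j *\<^sub>R axis (e (2 * j - 1)) 1 + c j *\<^sub>R axis (e (2 * j)) 1) $ e i
        = (\<Sum>j=1..k. (if i = 2 * j - 1 then b j else 0) + (if i = 2 * j then c j else 0))"
      unfolding sum_component using that by (intro sum.cong refl) (auto simp: axis_def e_eq_iff)
    then show ?thesis using that by (simp add: of_coords_def axis_def e_eq_iff)
  qed
  show "of_coords a b c $ e 0 = a"
    unfolding *[OF le0] by (auto intro: sum.neutral)
  show "of_coords a b c $ e (2 * i - Suc 0) = b i" if i: "i \<in> {1..k}"
  proof -
    have "2 * i - 1 = 2 * j - 1 \<longleftrightarrow> i = j" "2 * i - 1 \<noteq> 2 * j" if "j \<in> {1..k}" for j
      using i that by (auto, presburger)
    then have "of_coords a b c $ e (2 * i - Suc 0) = (\<Sum>j=1..k. if i = j then b j else 0)"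
      using i by (subst *) (auto intro!: sum.cong)
    then show ?thesis using i by simp
  qed
  show "of_coords a b c $ e (2 * i) = c i" if i: "i \<in> {1..k}"
  proof -
    have "2 * i \<noteq> 2 * j - 1" if "j \<in> {1..k}" for j
      using i that by (auto, presburger)
    then have "of_coords a b c $ e (2 * i) = (\<Sum>j=1..k. if i = j then c j else 0)"
      using i by (subst *) (auto intro!: sum.cong)
    then show ?thesis using i by simp
  qed
qed

lemma coords_eqI:
  assumes "x $ e 0 = y $ e 0"
    and "\<And>j. j \<in> {1..k} \<Longrightarrow> x $ e (2 * j - 1) = y $ e (2 * j - 1)"
    and "\<And>j. j \<in> {1..k} \<Longrightarrow> x $ e (2 * j) = y $ e (2 * j)"
  shows "x = y"
proof (subst vec_eq_iff, intro allI)
  fix i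
  obtain m where m: "m \<le> 2 * k" "i = e m"
    using e by (metis UNIV_I atMost_iff bij_betw_def imageE)
  consider "m = 0" | j where "j \<in> {1..k}" "m = 2 * j - 1" | j where "j \<in> {1..k}" "m = 2 * j"
  proof (cases "even m")
    case True
    then obtain j where "m = 2 * j" by blast
    then show ?thesis using that(1) that(3)[of j] m(1) by (cases "j = 0") auto
  next
    case False
    then obtain j where "m = 2 * j + 1" using oddE by blast
    then show ?thesis using that(2)[of "j + 1"] m(1) by auto
  qed
  then show "x $ i = y $ i" by cases (use m assms in auto)
qed

lemma of_coords_eq:
  "of_coords (x $ e 0) (\<lambda>j. x $ e (2 * j - 1)) (\<lambda>j. x $ e (2 * j)) = x"
  by (rule coords_eqI) auto

lemma inner_coords:
  "x \<bullet> x = (x $ e 0)\<^sup>2 + (\<Sum>j=1..k. (x $ e (2 * j - 1))\<^sup>2 + (x $ e (2 * j))\<^sup>2)"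
  using inner_of_coords[of x "x $ e 0" "\<lambda>j. x $ e (2 * j - 1)" "\<lambda>j. x $ e (2 * j)"]
  unfolding of_coords_eq by (simp add: power2_eq_square)

text \<open>Each cosine-sine pair contributes 1. This makes the squared distance to a fixed point a
  quadratic with leading coefficient 1 plus a trigonometric polynomial.\<close>

lemma inner_helix: "h s \<bullet> h s = s\<^sup>2 + real k"
  unfolding inner_coords helix_of_coords by simp

text \<open>Slot 0 carries the constant term. Without the case split, \<open>2 * j - 1\<close> would
  truncate to 0 there and pick the axial coordinate.\<close>

definition coeff_cos :: "real \<Rightarrow> real ^ 'n \<Rightarrow> nat \<Rightarrow> real" where
  "coeff_cos \<rho> y j = (if j = 0 then \<rho> else y $ e (2 * j - 1))"

text \<open>At index 0 the sine coefficient reads the axial coordinate, which is harmless because it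
  multiplies \<open>sin 0\<close>.\<close>

lemma affine_helix:
  "q * s\<^sup>2 + (\<rho> + y \<bullet> h s) = quad_trig q (y $ e 0) k (coeff_cos \<rho> y) (\<lambda>j. y $ e (2 * j)) s"
proof -
  have "{..k} = insert 0 {1..k}" by auto
  then have "trig_poly k (coeff_cos \<rho> y) (\<lambda>j. y $ e (2 * j)) s =
      \<rho> + (\<Sum>j=1..k. cos (real j * s) * y $ e (2 * j - 1) + sin (real j * s) * y $ e (2 * j))"
    by (simp add: trig_poly_def coeff_cos_def mult.commute)
  then show ?thesis
    by (simp add: quad_trig_def helix_of_coords inner_of_coords mult.commute)
qed

lemma dist_helix:
  obtains B \<alpha> \<beta> where "\<And>s. (dist x (h s))\<^sup>2 - R = quad_trig 1 B k \<alpha> \<beta> s"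
proof
  show "(dist x (h s))\<^sup>2 - R =
      quad_trig 1 ((- 2 *\<^sub>R x) $ e 0) k (coeff_cos (x \<bullet> x + real k - R) (- 2 *\<^sub>R x))
        (\<lambda>j. (- 2 *\<^sub>R x) $ e (2 * j)) s" for s
    unfolding affine_helix[symmetric]
    by (simp add: dist_norm power2_norm_eq_inner inner_diff inner_helix inner_commute algebra_simps)
qed

text \<open>A vector orthogonal to all lifts gives a function with \<open>q = 0\<close> and
  \<open>2 * k + 2\<close> zeros, so all its coefficients vanish. Hence the lifts span, and there
  are no more of them than the dimension.\<close>

lemma helix_lift_independent:
  assumes S: "finite S" "card S = 2 * k + 2" "S \<subseteq> {u..u + 2 * pi}"
  shows "independent ((\<lambda>s. (1 :: real, h s)) ` S)"
proof -
  let ?L = "(\<lambda>s. (1 :: real, h s)) ` S"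
  have "span ?L = UNIV"
  proof (rule ccontr)
    assume "span ?L \<noteq> UNIV"
    then obtain w where w: "w \<noteq> 0" "\<forall>x\<in>span ?L. w \<bullet> x = 0"
      using span_not_UNIV_orthogonal by blast
    obtain \<rho> y where wy: "w = (\<rho>, y)" by fastforce
    let ?\<alpha> = "coeff_cos \<rho> y" and ?\<beta> = "\<lambda>j. y $ e (2 * j)"
    have zero: "quad_trig 0 (y $ e 0) k ?\<alpha> ?\<beta> s = 0" if "s \<in> S" for s
    proof -
      have "w \<bullet> (1, h s) = 0" using w(2) that by (intro bspec[OF w(2)] span_base) auto
      then show ?thesis using affine_helix[of 0 s \<rho> y] by (simp add: wy inner_Pair)
    qed
    have y0: "y $ e 0 = 0"
      using quad_trig_many_zeros_linear[OF S(1) _ S(3) zero] S(2) by simp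
    \<comment> \<open>Dropping the right end gives a half-open period and costs at most one
      zero.\<close>
    let ?Z = "S - {u + 2 * pi}"
    have Z: "finite ?Z" "?Z \<subseteq> {u..<u + 2 * pi}" "2 * k + 1 \<le> card ?Z"
      using S by (auto simp: less_le card_Diff_singleton_if)
    have tz: "trig_poly k ?\<alpha> ?\<beta> s = 0" if "s \<in> ?Z" for s
      using zero[of s] that y0 by (simp add: quad_trig_def)
    have "\<rho> = 0" using trig_poly_const_eq_0[OF Z(1,3,2) tz] by (simp add: coeff_cos_def)
    moreover have "y = 0"
    proof (rule coords_eqI)
      fix j assume "j \<in> {1..k}"
      from trig_poly_coeff_eq_0[OF Z(1,3,2) tz this] this
      show "y $ e (2 * j - 1) = 0 $ e (2 * j - 1)" "y $ e (2 * j) = 0 $ e (2 * j)"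
        by (auto simp: coeff_cos_def)
    qed (use y0 in simp)
    ultimately show False using w(1) wy by (simp add: zero_prod_def)
  qed
  moreover have "card ?L \<le> DIM(real \<times> (real ^ 'n))"
    using card_image_le[OF S(1), of "\<lambda>s. (1 :: real, h s)"] S(2) card_index
    unfolding DIM_prod DIM_cart by simp
  ultimately show ?thesis
    using S(1) card_index by (intro card_le_dim_spanning[of _ UNIV]) (auto simp del: dim_UNIV simp: dim_UNIV)
qed

lemma helix_nth_0: "h s $ e 0 = s"
  by (simp add: helix_of_coords)

lemma inj_helix_lift: "inj (\<lambda>s. (1 :: real, h s))"
  by (rule injI) (metis helix_nth_0 prod.inject)

text \<open>Independence allows \<open>s\<^sup>2\<close> to be interpolated by an affine function
  \<rho> plus \<open>y \<bullet> h s\<close> on \<open>S\<close>. Completing the square, with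
  \<open>inner_helix\<close>, places the centre at \<open>y /\<^sub>R 2\<close>.\<close>

lemma helix_sphere:
  assumes "finite S" "card S = 2 * k + 2" "S \<subseteq> {u..u + 2 * pi}"
  obtains c R where "\<And>s. s \<in> S \<Longrightarrow> (dist c (h s))\<^sup>2 = R"
proof -
  have "independent ((\<lambda>s. (1 :: real, h s)) ` S)" by (rule helix_lift_independent[OF assms])
  from linear_independent_extend[OF this, of "\<lambda>v. (snd v $ e 0)\<^sup>2"]
  obtain g where g: "linear g" "\<And>s. s \<in> S \<Longrightarrow> g (1 :: real, h s) = s\<^sup>2"
    by (auto simp: helix_nth_0)
  \<comment> \<open>The vector representing the functional \<open>g\<close> through the inner
    product.\<close>
  obtain \<rho> y where wy: "adjoint g 1 = (\<rho>, y)" by fastforce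
  have *: "\<rho> + h s \<bullet> y = s\<^sup>2" if "s \<in> S" for s
    using g(2)[OF that] adjoint_works[OF g(1), of "(1, h s)" 1] by (simp add: wy inner_Pair)
  show thesis
  proof (rule that[of _ "y \<bullet> y / 4 + real k + \<rho>"])
    fix s assume "s \<in> S"
    then show "(dist (y /\<^sub>R 2) (h s))\<^sup>2 = y \<bullet> y / 4 + real k + \<rho>"
      using *[of s] by (simp add: dist_norm power2_norm_eq_inner inner_diff inner_helix inner_commute)
  qed
qed

lemma helix_point_node: "helix_point k e n t = h (node n (of_int t))"
  by (simp add: helix_point_def node_def)

section \<open>Screw motions and congruence\<close>

lemma norm_eq_coords:
  fixes x y :: "real ^ 'n"
  assumes "(x $ e 0)\<^sup>2 = (y $ e 0)\<^sup>2"
    and "\<And>j. j \<in> {1..k} \<Longrightarrow> (x $ e (2 * j - 1))\<^sup>2 + (x $ e (2 * j))\<^sup>2 = (y $ e (2 * j - 1))\<^sup>2 + (y $ e (2 * j))\<^sup>2"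
  shows "norm x = norm y"
proof -
  have "x \<bullet> x = y \<bullet> y"
    unfolding inner_coords assms(1) by (simp only: assms(2) cong: sum.cong)
  then show ?thesis by (simp add: norm_eq_sqrt_inner)
qed

text \<open>Translation by \<theta> along the axis combined with rotation of the \<open>j\<close>-th
  coordinate plane by \<open>j\<close> times \<theta>; it slides the helix along itself.\<close>

definition screw :: "real \<Rightarrow> real ^ 'n \<Rightarrow> real ^ 'n" where
  "screw \<theta> x = of_coords (x $ e 0 + \<theta>)
     (\<lambda>j. cos (real j * \<theta>) * x $ e (2 * j - 1) - sin (real j * \<theta>) * x $ e (2 * j))
     (\<lambda>j. sin (real j * \<theta>) * x $ e (2 * j - 1) + cos (real j * \<theta>) * x $ e (2 * j))"

lemma screw_nth [simp]:
  "screw \<theta> x $ e 0 = x $ e 0 + \<theta>"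
  "j \<in> {1..k} \<Longrightarrow> screw \<theta> x $ e (2 * j - Suc 0) =
     cos (real j * \<theta>) * x $ e (2 * j - Suc 0) - sin (real j * \<theta>) * x $ e (2 * j)"
  "j \<in> {1..k} \<Longrightarrow> screw \<theta> x $ e (2 * j) =
     sin (real j * \<theta>) * x $ e (2 * j - Suc 0) + cos (real j * \<theta>) * x $ e (2 * j)"
  by (simp_all add: screw_def)

lemma rotation_sum_squares:
  fixes c s u v :: real
  assumes "c\<^sup>2 + s\<^sup>2 = 1"
  shows "(c * u - s * v)\<^sup>2 + (s * u + c * v)\<^sup>2 = u\<^sup>2 + v\<^sup>2"
proof -
  have "(c * u - s * v)\<^sup>2 + (s * u + c * v)\<^sup>2 = (c\<^sup>2 + s\<^sup>2) * (u\<^sup>2 + v\<^sup>2)"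
    by (simp add: power2_eq_square algebra_simps)
  then show ?thesis using assms by simp
qed

lemma dist_screw: "dist (screw \<theta> x) (screw \<theta> y) = dist x y"
  unfolding dist_norm
proof (rule norm_eq_coords)
  fix j assume j: "j \<in> {1..k}"
  let ?u = "(x - y) $ e (2 * j - 1)" and ?v = "(x - y) $ e (2 * j)"
  have "(screw \<theta> x - screw \<theta> y) $ e (2 * j - 1) = cos (real j * \<theta>) * ?u - sin (real j * \<theta>) * ?v"
    "(screw \<theta> x - screw \<theta> y) $ e (2 * j) = sin (real j * \<theta>) * ?u + cos (real j * \<theta>) * ?v"
    using j by (simp, simp add: algebra_simps)+
  then show "((screw \<theta> x - screw \<theta> y) $ e (2 * j - 1))\<^sup>2 + ((screw \<theta> x - screw \<theta> y) $ e (2 * j))\<^sup>2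
      = ?u\<^sup>2 + ?v\<^sup>2"
    by (simp only: rotation_sum_squares[OF sin_cos_squared_add2])
qed simp

lemma screw_minus: "screw \<theta> (screw (- \<theta>) x) = x"
proof (rule coords_eqI)
  fix j assume j: "j \<in> {1..k}"
  let ?c = "cos (real j * \<theta>)" and ?s = "sin (real j * \<theta>)"
  let ?u = "x $ e (2 * j - 1)" and ?v = "x $ e (2 * j)"
  have inv: "c * (c * u + s * v) - s * (c * v - s * u) = u" "s * (c * u + s * v) + c * (c * v - s * u) = v"
    if "c\<^sup>2 + s\<^sup>2 = 1" for c s u v :: real
  proof -
    have "c * (c * u + s * v) - s * (c * v - s * u) = (c\<^sup>2 + s\<^sup>2) * u"
      "s * (c * u + s * v) + c * (c * v - s * u) = (c\<^sup>2 + s\<^sup>2) * v"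
      by (simp_all add: power2_eq_square algebra_simps)
    then show "c * (c * u + s * v) - s * (c * v - s * u) = u" "s * (c * u + s * v) + c * (c * v - s * u) = v"
      unfolding that by simp_all
  qed
  have "screw (- \<theta>) x $ e (2 * j - 1) = ?c * ?u + ?s * ?v" "screw (- \<theta>) x $ e (2 * j) = ?c * ?v - ?s * ?u"
    using j by simp_all
  then show "screw \<theta> (screw (- \<theta>) x) $ e (2 * j - 1) = ?u" "screw \<theta> (screw (- \<theta>) x) $ e (2 * j) = ?v"
    using j inv[of ?c ?s] by simp_all
qed simp

lemma bij_screw: "bij (screw \<theta>)"
  using screw_minus[of \<theta>] screw_minus[of "- \<theta>"] by (intro bijI') (auto, metis, metis)

lemma screw_helix: "screw \<theta> (h s) = h (s + \<theta>)"
  unfolding helix_of_coords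
  by (rule coords_eqI) (simp_all add: distrib_left cos_add sin_add)

lemma screw_helix_point:
  "screw (node n (of_int u)) (helix_point k e n t) = helix_point k e n (t + u)"
  unfolding helix_point_node screw_helix
  by (simp add: node_def add_divide_distrib algebra_simps)

text \<open>The screw motion by \<open>t - s\<close> lattice steps permutes the helix points, hence
  their Voronoi regions.\<close>

lemma congruent_voronoi_regions:
  "congruent_sets (voronoi_region (helix_points k e n) (helix_point k e n s))
     (voronoi_region (helix_points k e n) (helix_point k e n t))"
proof -
  let ?f = "screw (node n (of_int (t - s)))"
  have "?f ` helix_points k e n = (\<lambda>u. helix_point k e n (u + (t - s))) ` UNIV"
    unfolding helix_points_def image_image screw_helix_point by simp
  also have "\<dots> = helix_point k e n ` (\<lambda>u. u + (t - s)) ` UNIV"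
    by (simp only: image_image)
  also have "range (\<lambda>u. u + (t - s)) = UNIV" by (rule surj_plus_right)
  finally have "?f ` helix_points k e n = helix_points k e n" by (simp only: helix_points_def)
  from voronoi_region_image[OF bij_screw dist_screw this, of "helix_point k e n s"]
  show ?thesis
    unfolding congruent_sets_def screw_helix_point
    using bij_screw[of "node n (of_int (t - s))"] dist_screw[of "node n (of_int (t - s))"] by auto
qed

section \<open>Polyhedrality of the Voronoi regions\<close>

lemma polyhedron_dist_le_dist:
  "polyhedron {x :: 'a::euclidean_space. dist x p \<le> dist x q}"
  unfolding dist_le_dist_iff by (rule polyhedron_halfspace_le)

text \<open>The excess of the squared distance over that to point \<open>t\<close> vanishes at
  \<open>t\<close>. If it is nonnegative at the \<open>n\<close> neighbours on either side,
  \<open>periodic_growth\<close> with \<open>a = b = t\<close> makes it positive beyond them, so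
  finitely many halfspaces suffice.\<close>

lemma polyhedron_voronoi_region:
  assumes n: "n \<ge> 1"
  shows "polyhedron (voronoi_region (helix_points k e n) (helix_point k e n t))"
proof -
  let ?P = "helix_point k e n"
  let ?W = "{t - int n..t + int n}"
  have far: "dist x (?P t) \<le> dist x (?P s)" if near: "\<And>u. u \<in> ?W \<Longrightarrow> dist x (?P t) \<le> dist x (?P u)" for x s
  proof (cases "s \<in> ?W")
    case False
    obtain B \<alpha> \<beta> where f: "\<And>u. (dist x (h u))\<^sup>2 - (dist x (?P t))\<^sup>2 = quad_trig 1 B k \<alpha> \<beta> u"
      using dist_helix by blast
    let ?F = "\<lambda>u. quad_trig 1 B k \<alpha> \<beta> (node n (of_int u))"
    have F: "?F u = (dist x (?P u))\<^sup>2 - (dist x (?P t))\<^sup>2" for u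
      unfolding f[symmetric] helix_point_node ..
    have "?F s > 0"
    proof (rule periodic_growth[where F = ?F and a = t and b = t and n = "int n"])
      show "?F (u + int n) = ?F u + (4 * pi * 1 * (2 * pi / n)) * of_int u + (4 * pi\<^sup>2 * 1 + 2 * pi * B)" for u
        by (rule quad_trig_node_shift[OF n])
      show "?F u \<ge> 0" if "u \<in> ?W" for u
        unfolding F using near[OF that] by simp
      show "?F t = 0" "?F t = 0" unfolding F by simp_all
    qed (use n False in auto)
    then have "(dist x (?P t))\<^sup>2 \<le> (dist x (?P s))\<^sup>2" unfolding F by linarith
    then show ?thesis by (rule power2_le_imp_le) simp
  qed (rule near)
  have "voronoi_region (helix_points k e n) (?P t) = (\<Inter>s\<in>?W. {x. dist x (?P t) \<le> dist x (?P s)})"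
    using far by (auto simp: voronoi_region_def helix_points_def)
  also have "polyhedron \<dots>"
    by (rule polyhedron_Inter) (auto intro: polyhedron_dist_le_dist)
  finally show ?thesis .
qed

section \<open>Empty spheres and the dimension count\<close>

lemma finite_helix_points_near:
  assumes n: "n \<ge> 1"
  shows "finite {t. dist c (helix_point k e n t) \<le> M}"
proof (rule finite_subset)
  show "{t. dist c (helix_point k e n t) \<le> M}
      \<subseteq> {\<lceil>(c $ e 0 - M) * n / (2 * pi)\<rceil>..\<lfloor>(c $ e 0 + M) * n / (2 * pi)\<rfloor>}"
  proof
    fix t assume "t \<in> {t. dist c (helix_point k e n t) \<le> M}"
    then have "\<bar>c $ e 0 - node n (of_int t)\<bar> \<le> M"
      using component_le_norm_cart[of "c - helix_point k e n t" "e 0"]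
      by (simp add: dist_norm helix_point_node helix_nth_0)
    then have "c $ e 0 - M \<le> node n (of_int t)" "node n (of_int t) \<le> c $ e 0 + M" by auto
    then show "t \<in> {\<lceil>(c $ e 0 - M) * n / (2 * pi)\<rceil>..\<lfloor>(c $ e 0 + M) * n / (2 * pi)\<rfloor>}"
      using n by (auto simp: node_def ceiling_le_iff le_floor_iff field_simps)
  qed
qed simp

lemma empty_sphere:
  assumes n: "n \<ge> 1" and J: "finite J" "card J = k + 1" "J \<subseteq> {m..m + int n}"
  obtains c r where "\<And>t. t \<in> J \<Longrightarrow> dist c (helix_point k e n t) = r"
    "\<And>t. t \<notin> J \<Longrightarrow> dist c (helix_point k e n t) > r"
    "independent ((\<lambda>t. (1 :: real, helix_point k e n t)) ` J)"
proof (cases "k = 0")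
  case True
  \<comment> \<open>For \<open>k = 0\<close> the single chosen point is itself a sphere of radius
    0.\<close>
  then obtain t where t: "J = {t}" using J(2) by (auto simp: card_1_singleton_iff)
  have "helix_point k e n u \<noteq> helix_point k e n t" if "u \<noteq> t" for u
    using helix_nth_0 that n unfolding helix_point_node by (metis node_eq_iff of_int_eq_iff)
  then show ?thesis
    using that[of "helix_point k e n t" 0] by (auto simp: t zero_prod_def) metis
next
  case False
  have ne: "J \<noteq> {}" using J(2) by auto
  interpret node_window k n J "Min J" "Max J"
  proof
    show "Max J \<le> Min J + int n"
      using subsetD[OF J(3) Max_in[OF J(1) ne]] subsetD[OF J(3) Min_in[OF J(1) ne]]
      unfolding atLeastAtMost_iff by linarith
  qed (use False n J ne in auto)
  obtain c R where c: "\<And>s. s \<in> S \<Longrightarrow> (dist c (h s))\<^sup>2 = R"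
    using helix_sphere[OF finS cardS S_window(1)] by blast
  obtain B \<alpha> \<beta> where f: "\<And>s. (dist c (h s))\<^sup>2 - R = quad_trig 1 B k \<alpha> \<beta> s"
    using dist_helix by blast
  interpret paired_zeros k n J "Min J" "Max J" B \<alpha> \<beta>
    by unfold_locales (simp add: c flip: f)
  have R: "R \<ge> 0" using c[of "node n (of_int (Min J))"] node_in_S_iff ends by (metis zero_le_power2)
  show thesis
  proof (rule that[of c "sqrt R"])
    show "dist c (helix_point k e n t) = sqrt R" if "t \<in> J" for t
      using c[of "node n (of_int t)"] that node_in_S_iff by (simp add: helix_point_node real_sqrt_unique)
    show "dist c (helix_point k e n t) > sqrt R" if "t \<notin> J" for t
      using positive[OF that] by (simp add: helix_point_node real_less_lsqrt flip: f)
    \<comment> \<open>The chosen lifts inherit independence from the full set of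
      \<open>2 * k + 2\<close> lifts.\<close>
    have "(\<lambda>t. (1 :: real, helix_point k e n t)) ` J \<subseteq> (\<lambda>s. (1, h s)) ` S"
      unfolding helix_point_node using node_in_S_iff by auto
    then show "independent ((\<lambda>t. (1 :: real, helix_point k e n t)) ` J)"
      using helix_lift_independent[OF finS cardS S_window(1)] independent_mono by blast
  qed
qed

lemma aff_dim_voronoi_regions_Inter:
  assumes n: "n \<ge> 1" and J: "finite J" "card J = k + 1" "J \<subseteq> {m..m + int n}"
  shows "aff_dim (\<Inter>t\<in>J. voronoi_region (helix_points k e n) (helix_point k e n t))
    = int CARD('n) - int (k + 1) + 1"
proof -
  let ?P = "helix_point k e n"
  obtain c r where c: "\<And>t. t \<in> J \<Longrightarrow> dist c (?P t) = r" "\<And>t. t \<notin> J \<Longrightarrow> dist c (?P t) > r"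
    "independent ((\<lambda>t. (1 :: real, ?P t)) ` J)"
    using empty_sphere[OF n J] by blast
  \<comment> \<open>Only finitely many unchosen points come within 1 of the sphere, so strict
    exteriority improves to a uniform margin: the least excess over \<open>r\<close> in
    \<open>N\<close>, capped at 1 for the points outside \<open>N\<close>.\<close>
  define N where "N = {t. dist c (?P t) \<le> r + 1} - J"
  have N: "finite N" unfolding N_def using finite_helix_points_near[OF n] by blast
  define \<delta> where "\<delta> = Min (insert 1 ((\<lambda>t. dist c (?P t) - r) ` N)) / 2"
  have d: "\<delta> > 0" using N c(2) by (auto simp: \<delta>_def N_def)
  have "dist c (?P t) \<ge> r + 2 * \<delta>" if "t \<notin> J" for t
  proof (cases "t \<in> N")
    case True
    then have "2 * \<delta> \<le> dist c (?P t) - r" using N by (auto simp: \<delta>_def intro: Min_le)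
    then show ?thesis by simp
  next
    case False
    have "2 * \<delta> \<le> 1" using N by (auto simp: \<delta>_def intro: Min_le)
    with False that show ?thesis by (simp add: N_def)
  qed
  moreover have "inj_on (\<lambda>t. (1 :: real, ?P t)) J"
    using inj_helix_lift n unfolding helix_point_node
    by (intro inj_onI) (metis (mono_tags, lifting) injD node_eq_iff of_int_eq_iff)
  moreover have "J \<noteq> {}" using J(2) by auto
  ultimately have "aff_dim (\<Inter>t\<in>J. voronoi_region (range ?P) (?P t)) = int DIM(real ^ 'n) - int (card J) + 1"
    using J(1) c d by (intro aff_dim_voronoi_Inter[where c = c and r = r and \<delta> = \<delta>])
  then show ?thesis using J(2) by (simp add: helix_points_def)
qed

end

theorem theorem6:
  fixes k n :: nat and m :: int and e :: "nat \<Rightarrow> 'n::finite"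
  assumes "n \<ge> 1"
    and "bij_betw e {..2 * k} (UNIV :: 'n set)"
  shows "neighborly_family (k + 1) {m..m + int n}
           (\<lambda>t. voronoi_region (helix_points k e n) (helix_point k e n t)) \<and>
         congruent_family {m..m + int n}
           (\<lambda>t. voronoi_region (helix_points k e n) (helix_point k e n t))"
proof -
  interpret helix k e by unfold_locales (rule assms(2))
  show ?thesis
    unfolding neighborly_family_def congruent_family_def
    using polyhedron_voronoi_region[OF assms(1)] congruent_voronoi_regions
      aff_dim_voronoi_regions_Inter[OF assms(1)] by auto
qed

end
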